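(* Let $F,L,K$ be number fields such that $K/F$ is cyclic of degree $n$ with $\mathrm{Gal}(K/F)=\langle\rho\rangle$, $K/L$ is cyclic of degree $m$ with $\mathrm{Gal}(K/L)=\langle\sigma\rangle$, and $\rho\sigma=\sigma\rho$; put $F_0=F\cap L$. Let $c\in\mathcal{O}_{F_0}^\times$ be such that $D=(K/F,\rho,c)$ is a division algebra, let $\mathcal{D}=\bigoplus_{i=0}^{n-1}\mathcal{O}_Ke^i$ (with $ex=\rho(x)e$, $e^n=c$) be its natural order, and extend $\sigma$ to $\mathcal{D}$ coefficientwise. Let $d\in\mathcal{O}_L^\times$ with $t^m-d$ irreducible in $D[t;\sigma]$ and $\Lambda=\mathcal{D}[t;\sigma]/\mathcal{D}[t;\sigma](t^m-d)$. Let $\mathcal{I}=\mathfrak{q}_1^{s_1}\cdots\mathfrak{q}_l^{s_l}$ be a non-zero ideal of $\mathcal{O}_{F_0}$ with distinct prime ideals $\mathfrak{q}_j$, and for $1\le j\le l$ let $$D_j=\big((\mathcal{O}_K/\mathfrak{q}_j^{s_j}\mathcal{O}_K)/(\mathcal{O}_F/\mathfrak{q}_j^{s_j}\mathcal{O}_F),\overline{\rho},c+\mathfrak{q}_j^{s_j}\mathcal{O}_K\big),$$ with $\overline{\rho}(u+\mathfrak{q}_j^{s_j}\mathcal{O}_K)=\rho(u)+\mathfrak{q}_j^{s_j}\mathcal{O}_K$, and with $\overline{\sigma}$ acting on $D_j$ coefficientwise via $\overline{\sigma}(u+\mathfrak{q}_j^{s_j}\mathcal{O}_K)=\sigma(u)+\mathfrak{q}_j^{s_j}\mathcal{O}_K$.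 If $\mathcal{D}/\mathcal{I}\mathcal{D}\cong D_1\times\dots\times D_l$, then $$\Lambda/\mathcal{I}\Lambda\cong D_1[t;\overline{\sigma}]/D_1[t;\overline{\sigma}](t^m-\bar d_1)\times\dots\times D_l[t;\overline{\sigma}]/D_l[t;\overline{\sigma}](t^m-\bar d_l),$$ equivalently $\Lambda/\mathcal{I}\Lambda\cong(D_1,\overline{\sigma},\bar d_1)\times\dots\times(D_l,\overline{\sigma},\bar d_l)$, where $\bar d_j=d+\mathfrak{q}_j^{s_j}\mathcal{O}_K$.
   Context: For a unital associative ring $S$ with injective endomorphism $\sigma$, $S[t;\sigma]$ is the skew polynomial ring with $ta=\sigma(a)t$. For monic $f$ of degree $m$, $S[t;\sigma]/S[t;\sigma]f$ (the Petit algebra) is the set of polynomials of degree $<m$ with multiplication $g\circ h=gh\bmod_r f$ (remainder of right division by $f$), a unital nonassociative ring; $(S,\sigma,g)$ denotes $S[t;\sigma]/S[t;\sigma](t^m-g)$. For commutative rings $S_0\subset S$ with $S_0\subset\mathrm{Fix}(\rho)$, $(S/S_0,\rho,c)$ denotes $S[e;\rho]/S[e;\rho](e^n-c)$, a generalized associative cyclic algebra when $c\in S_0$. Products of rings have componentwise operations. *)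

theory Defs
  imports "HOL-Algebra.QuotRing" "HOL-Algebra.Ideal_Product"
          "HOL-Computational_Algebra.Polynomial"
begin

definition is_subfield_C :: "complex set \<Rightarrow> bool" where
  "is_subfield_C K \<longleftrightarrow> 0 \<in> K \<and> 1 \<in> K \<and>
     (\<forall>x\<in>K. \<forall>y\<in>K. x + y \<in> K \<and> x - y \<in> K \<and> x * y \<in> K) \<and>
     (\<forall>x\<in>K. x \<noteq> 0 \<longrightarrow> inverse x \<in> K)"

definition field_degree :: "complex set \<Rightarrow> complex set \<Rightarrow> nat \<Rightarrow> bool" where
  "field_degree K F n \<longleftrightarrow> (\<exists>B. B \<subseteq> K \<and> finite B \<and> card B = n \<and>
     (\<forall>x\<in>K. \<exists>r. (\<forall>b\<in>B. r b \<in> F) \<and> x = (\<Sum>b\<in>B. r b * b)) \<and>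
     (\<forall>r. (\<forall>b\<in>B. r b \<in> F) \<and> (\<Sum>b\<in>B. r b * b) = 0 \<longrightarrow> (\<forall>b\<in>B. r b = 0)))"

definition is_number_field :: "complex set \<Rightarrow> bool" where
  "is_number_field K \<longleftrightarrow> is_subfield_C K \<and> (\<exists>n. field_degree K \<rat> n)"

definition ring_of_integers :: "complex set \<Rightarrow> complex set" where
  "ring_of_integers K = {x \<in> K. algebraic_int x}"

definition units_of_set :: "complex set \<Rightarrow> complex set" where
  "units_of_set R = {x \<in> R. x \<noteq> 0 \<and> inverse x \<in> R}"

definition gal :: "complex set \<Rightarrow> complex set \<Rightarrow> (complex \<Rightarrow> complex) set" where
  "gal K F = {g. g ` K = K \<and> inj_on g K \<and>
      (\<forall>x\<in>K. \<forall>y\<in>K. g (x + y) = g x + g y \<and> g (x * y) = g x * g y) \<and> g 1 = 1 \<and>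
      (\<forall>x\<in>F. g x = x) \<and> (\<forall>x. x \<notin> K \<longrightarrow> g x = x)}"

definition cyclic_ext :: "complex set \<Rightarrow> complex set \<Rightarrow> nat \<Rightarrow> (complex \<Rightarrow> complex) \<Rightarrow> bool" where
  "cyclic_ext K F n \<rho> \<longleftrightarrow> F \<subseteq> K \<and> field_degree K F n \<and> card (gal K F) = n \<and>
      \<rho> \<in> gal K F \<and> gal K F = range (\<lambda>k. \<rho> ^^ k)"

definition ring_of_set :: "complex set \<Rightarrow> complex ring" where
  "ring_of_set S = \<lparr>Congruence.partial_object.carrier = S, Group.monoid.mult = (*), Group.monoid.one = 1, Ring.ring.zero = 0, Ring.ring.add = (+)\<rparr>"

text \<open>Skew polynomials are coefficient functions with finite support; multiplication
  (a t^i)(b t^j) = a sigma^i(b) t^(i+j).\<close>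
definition skew_carrier :: "('a, 'b) ring_scheme \<Rightarrow> (nat \<Rightarrow> 'a) set" where
  "skew_carrier R = {p. (\<forall>i. p i \<in> carrier R) \<and> (\<exists>N. \<forall>i\<ge>N. p i = \<zero>\<^bsub>R\<^esub>)}"

definition skew_add :: "('a, 'b) ring_scheme \<Rightarrow> (nat \<Rightarrow> 'a) \<Rightarrow> (nat \<Rightarrow> 'a) \<Rightarrow> (nat \<Rightarrow> 'a)" where
  "skew_add R p q = (\<lambda>i. p i \<oplus>\<^bsub>R\<^esub> q i)"

definition skew_mult :: "('a, 'b) ring_scheme \<Rightarrow> ('a \<Rightarrow> 'a) \<Rightarrow> (nat \<Rightarrow> 'a) \<Rightarrow> (nat \<Rightarrow> 'a) \<Rightarrow> (nat \<Rightarrow> 'a)" where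
  "skew_mult R \<sigma> p q = (\<lambda>k. foldr (\<lambda>i acc. (p i \<otimes>\<^bsub>R\<^esub> (\<sigma> ^^ i) (q (k - i))) \<oplus>\<^bsub>R\<^esub> acc)
                                   [0..<Suc k] \<zero>\<^bsub>R\<^esub>)"

definition cst :: "('a, 'b) ring_scheme \<Rightarrow> 'a \<Rightarrow> (nat \<Rightarrow> 'a)" where
  "cst R a = (\<lambda>i. if i = 0 then a else \<zero>\<^bsub>R\<^esub>)"

definition skew_poly_ring :: "('a, 'b) ring_scheme \<Rightarrow> ('a \<Rightarrow> 'a) \<Rightarrow> (nat \<Rightarrow> 'a) ring" where
  "skew_poly_ring R \<sigma> = \<lparr>Congruence.partial_object.carrier = skew_carrier R, Group.monoid.mult = skew_mult R \<sigma>,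
      Group.monoid.one = cst R \<one>\<^bsub>R\<^esub>, Ring.ring.zero = (\<lambda>i. \<zero>\<^bsub>R\<^esub>), Ring.ring.add = skew_add R\<rparr>"

definition tm_minus :: "('a, 'b) ring_scheme \<Rightarrow> nat \<Rightarrow> 'a \<Rightarrow> (nat \<Rightarrow> 'a)" where
  "tm_minus R m d = (\<lambda>i. (if i = m then \<one>\<^bsub>R\<^esub> else \<zero>\<^bsub>R\<^esub>) \<oplus>\<^bsub>R\<^esub> (if i = 0 then \<ominus>\<^bsub>R\<^esub> d else \<zero>\<^bsub>R\<^esub>))"

text \<open>Remainder of right division of g by the (monic, degree m) polynomial f.\<close>
definition rem_r :: "('a, 'b) ring_scheme \<Rightarrow> ('a \<Rightarrow> 'a) \<Rightarrow> nat \<Rightarrow> (nat \<Rightarrow> 'a) \<Rightarrow> (nat \<Rightarrow> 'a) \<Rightarrow> (nat \<Rightarrow> 'a)" where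
  "rem_r R \<sigma> m f g = (THE r. r \<in> skew_carrier R \<and> (\<forall>i\<ge>m. r i = \<zero>\<^bsub>R\<^esub>) \<and>
      (\<exists>q\<in>skew_carrier R. g = skew_add R (skew_mult R \<sigma> q f) r))"

text \<open>Petit algebra R[t;sigma]/R[t;sigma]f, f monic of degree m.\<close>
definition petit :: "('a, 'b) ring_scheme \<Rightarrow> ('a \<Rightarrow> 'a) \<Rightarrow> nat \<Rightarrow> (nat \<Rightarrow> 'a) \<Rightarrow> (nat \<Rightarrow> 'a) ring" where
  "petit R \<sigma> m f = \<lparr>Congruence.partial_object.carrier = {p \<in> skew_carrier R. \<forall>i\<ge>m. p i = \<zero>\<^bsub>R\<^esub>},
      Group.monoid.mult = (\<lambda>g h. rem_r R \<sigma> m f (skew_mult R \<sigma> g h)),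
      Group.monoid.one = cst R \<one>\<^bsub>R\<^esub>, Ring.ring.zero = (\<lambda>i. \<zero>\<^bsub>R\<^esub>), Ring.ring.add = skew_add R\<rparr>"

definition petit_tm :: "('a, 'b) ring_scheme \<Rightarrow> ('a \<Rightarrow> 'a) \<Rightarrow> nat \<Rightarrow> 'a \<Rightarrow> (nat \<Rightarrow> 'a) ring" where
  "petit_tm R \<sigma> m d = petit R \<sigma> m (tm_minus R m d)"

definition coeffwise :: "('a \<Rightarrow> 'a) \<Rightarrow> (nat \<Rightarrow> 'a) \<Rightarrow> (nat \<Rightarrow> 'a)" where
  "coeffwise \<sigma> p = (\<lambda>i. \<sigma> (p i))"

definition is_unit_in :: "('a, 'b) ring_scheme \<Rightarrow> 'a \<Rightarrow> bool" where
  "is_unit_in R x \<longleftrightarrow> x \<in> carrier R \<and>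
     (\<exists>y\<in>carrier R. x \<otimes>\<^bsub>R\<^esub> y = \<one>\<^bsub>R\<^esub> \<and> y \<otimes>\<^bsub>R\<^esub> x = \<one>\<^bsub>R\<^esub>)"

definition is_division_ring :: "('a, 'b) ring_scheme \<Rightarrow> bool" where
  "is_division_ring R \<longleftrightarrow> \<one>\<^bsub>R\<^esub> \<noteq> \<zero>\<^bsub>R\<^esub> \<and>
     (\<forall>x\<in>carrier R. x \<noteq> \<zero>\<^bsub>R\<^esub> \<longrightarrow> is_unit_in R x)"

definition irreducible_in :: "('a, 'b) ring_scheme \<Rightarrow> 'a \<Rightarrow> bool" where
  "irreducible_in R f \<longleftrightarrow> f \<in> carrier R \<and> f \<noteq> \<zero>\<^bsub>R\<^esub> \<and> \<not> is_unit_in R f \<and>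
     (\<forall>g\<in>carrier R. \<forall>h\<in>carrier R. f = g \<otimes>\<^bsub>R\<^esub> h \<longrightarrow> is_unit_in R g \<or> is_unit_in R h)"

definition ring_isom :: "('a, 'b) ring_scheme \<Rightarrow> ('c, 'd) ring_scheme \<Rightarrow> bool" where
  "ring_isom A B \<longleftrightarrow> (\<exists>h. bij_betw h (carrier A) (carrier B) \<and>
     (\<forall>x\<in>carrier A. \<forall>y\<in>carrier A. h (x \<oplus>\<^bsub>A\<^esub> y) = h x \<oplus>\<^bsub>B\<^esub> h y \<and>
                                  h (x \<otimes>\<^bsub>A\<^esub> y) = h x \<otimes>\<^bsub>B\<^esub> h y) \<and>
     h \<one>\<^bsub>A\<^esub> = \<one>\<^bsub>B\<^esub>)"

definition prod_ring :: "nat \<Rightarrow> (nat \<Rightarrow> ('a, 'b) ring_scheme) \<Rightarrow> (nat \<Rightarrow> 'a) ring" where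
  "prod_ring l R = \<lparr>Congruence.partial_object.carrier = (\<Pi>\<^sub>E j\<in>{1..l}. carrier (R j)),
      Group.monoid.mult = (\<lambda>x y. \<lambda>j\<in>{1..l}. x j \<otimes>\<^bsub>R j\<^esub> y j),
      Group.monoid.one = (\<lambda>j\<in>{1..l}. \<one>\<^bsub>R j\<^esub>), Ring.ring.zero = (\<lambda>j\<in>{1..l}. \<zero>\<^bsub>R j\<^esub>),
      Ring.ring.add = (\<lambda>x y. \<lambda>j\<in>{1..l}. x j \<oplus>\<^bsub>R j\<^esub> y j)\<rparr>"

text \<open>I*A for a ring A containing the scalars via iota: the additive subgroup
  generated by the products iota(a)*x, a in I, x in A.\<close>
inductive_set scalar_ext :: "('a, 'b) ring_scheme \<Rightarrow> ('c \<Rightarrow> 'a) \<Rightarrow> 'c set \<Rightarrow> 'a set"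
  for A \<iota> I where
    zero: "\<zero>\<^bsub>A\<^esub> \<in> scalar_ext A \<iota> I"
  | step: "\<lbrakk>a \<in> I; x \<in> carrier A; y \<in> scalar_ext A \<iota> I\<rbrakk>
           \<Longrightarrow> (\<iota> a \<otimes>\<^bsub>A\<^esub> x) \<oplus>\<^bsub>A\<^esub> y \<in> scalar_ext A \<iota> I"

primrec ideal_pow :: "('a, 'b) ring_scheme \<Rightarrow> 'a set \<Rightarrow> nat \<Rightarrow> 'a set" where
  "ideal_pow R q 0 = carrier R"
| "ideal_pow R q (Suc k) = ideal_prod R (ideal_pow R q k) q"

definition ideal_prod_list :: "('a, 'b) ring_scheme \<Rightarrow> 'a set list \<Rightarrow> 'a set" where
  "ideal_prod_list R Is = foldr (ideal_prod R) Is (carrier R)"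

definition quot_map :: "('a, 'b) ring_scheme \<Rightarrow> 'a set \<Rightarrow> ('a \<Rightarrow> 'a) \<Rightarrow> 'a set \<Rightarrow> 'a set" where
  "quot_map R J f X = the_elem ((\<lambda>u. J +>\<^bsub>R\<^esub> f u) ` X)"


abbreviation OKr :: "complex set \<Rightarrow> complex ring" where
  "OKr K \<equiv> ring_of_set (ring_of_integers K)"

text \<open>Natural order of (K/F,rho,c): sum of O_K e^i.\<close>
definition nat_order :: "complex set \<Rightarrow> (complex \<Rightarrow> complex) \<Rightarrow> nat \<Rightarrow> complex \<Rightarrow> (nat \<Rightarrow> complex) ring" where
  "nat_order K \<rho> n c = petit_tm (OKr K) \<rho> n c"

definition Lambda_ord :: "complex set \<Rightarrow> (complex \<Rightarrow> complex) \<Rightarrow> nat \<Rightarrow> complex \<Rightarrow>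
    (complex \<Rightarrow> complex) \<Rightarrow> nat \<Rightarrow> complex \<Rightarrow> (nat \<Rightarrow> nat \<Rightarrow> complex) ring" where
  "Lambda_ord K \<rho> n c \<sigma> m d = petit_tm (nat_order K \<rho> n c) (coeffwise \<sigma>) m (cst (OKr K) d)"

definition res_cyclic :: "complex set \<Rightarrow> complex set \<Rightarrow> (complex \<Rightarrow> complex) \<Rightarrow> nat \<Rightarrow> complex \<Rightarrow>
    (nat \<Rightarrow> complex set) ring" where
  "res_cyclic K Q \<rho> n c = petit_tm (OKr K Quot Q) (quot_map (OKr K) Q \<rho>) n (Q +>\<^bsub>OKr K\<^esub> c)"

definition res_petit :: "complex set \<Rightarrow> complex set \<Rightarrow> (complex \<Rightarrow> complex) \<Rightarrow> nat \<Rightarrow> complex \<Rightarrow>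
    (complex \<Rightarrow> complex) \<Rightarrow> nat \<Rightarrow> complex \<Rightarrow> (nat \<Rightarrow> nat \<Rightarrow> complex set) ring" where
  "res_petit K Q \<rho> n c \<sigma> m d = petit_tm (res_cyclic K Q \<rho> n c)
      (coeffwise (quot_map (OKr K) Q \<sigma>)) m (cst (OKr K Quot Q) (Q +>\<^bsub>OKr K\<^esub> d))"

end

theory Submission
  imports "Jordan_Normal_Form.Char_Poly" Defs
begin

text \<open>
  The isomorphism is reduction of coefficients. For an ideal \<open>Q\<close> of \<open>\<O>\<^sub>K\<close> stable under \<open>\<rho>\<close> and \<open>\<sigma>\<close>,
  reducing all coefficients modulo \<open>Q\<close> is compatible with division by \<open>e\<^sup>n - c\<close> and by \<open>t\<^sup>m - d\<close>,
  because remainders are unique; hence it is a homomorphism from \<open>\<Lambda>\<close> onto the Petit algebra over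
  \<open>\<O>\<^sub>K/Q\<close>. Distinct non-zero primes of \<open>\<O>\<^bsub>F0\<^esub>\<close> are maximal, so the ideals
  \<open>Q\<^sub>j\<close> generated by the prime powers are pairwise comaximal, and the Chinese remainder theorem in
  \<open>\<O>\<^sub>K\<close>, applied to each coefficient, shows that the reductions modulo the \<open>Q\<^sub>j\<close> are jointly
  surjective and that their common kernel consists of the elements with all coefficients in
  \<open>I\<O>\<^sub>K\<close>, which is \<open>I\<Lambda>\<close>.
\<close>

section \<open>Sums and products of algebraic integers\<close>

text \<open>\<Lambda> need not be associative, so neither ideals nor the isomorphism theorem of
  associative ring theory apply to the quotient of \<Lambda> by I\<Lambda>. Above O_K only addition,
  distributivity and a unit are used, and the quotient is controlled through the fibres of a
  surjective homomorphism. The two levels, D over O_K and \<Lambda> over D, come from one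
  construction applied twice. The arithmetic is kept inside A, the ring of integers of F0. Witnesses
  a + b = 1 of comaximality found in A remain witnesses in O_K, so the splitting of the primes in
  O_K never enters. Elements of A are fixed by \<rho> and \<sigma>, which makes the extended ideals
  stable and the induced maps on residues well defined. Maximality of a non-zero prime is reduced to
  a gcd argument in Z: modulo a prime, every non-zero algebraic integer divides a non-zero integer.
  That algebraic integers form a ring is needed before O_K can be treated as a ring at all; it rests
  on finding a finitely generated additive group stable under multiplication by the given
  element.\<close>

lemma algebraic_int_if_lattice_stable:
  fixes z :: "'a :: field_char_0"
  assumes S: "finite S" and s0: "s0 \<in> S" "s0 \<noteq> 0"
    and r: "\<And>s. s \<in> S \<Longrightarrow> z * s = (\<Sum>t\<in>S. of_int (r s t) * t)"
  shows "algebraic_int z"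
proof -
  obtain xs where xs: "set xs = S" "distinct xs"
    using finite_distinct_list[OF S] by blast
  define N where "N = length xs"
  define A :: "int mat" where "A = mat N N (\<lambda>(i, j). r (xs ! i) (xs ! j))"
  define B :: "'a mat" where "B = map_mat of_int A"
  define v where "v = vec N (\<lambda>i. xs ! i)"
  have cA: "A \<in> carrier_mat N N" and cB: "B \<in> carrier_mat N N" and cv: "v \<in> carrier_vec N"
    by (auto simp: A_def B_def v_def)
  \<comment> \<open>Multiplication by \<open>z\<close> acts on the vector of elements of
    \<open>S\<close> through the integer matrix \<open>A\<close>. So \<open>z\<close> is an
    eigenvalue, hence a root of the characteristic polynomial of \<open>A\<close>, which is monic
    with integer coefficients; \<open>s0\<close> makes the eigenvector non-zero.\<close>
  have "B *\<^sub>v v = z \<cdot>\<^sub>v v"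
  proof (rule eq_vecI)
    fix i assume "i < dim_vec (z \<cdot>\<^sub>v v)"
    then have i: "i < N" by (simp add: v_def)
    have "(B *\<^sub>v v) $ i = (\<Sum>j = 0..<N. of_int (r (xs ! i) (xs ! j)) * xs ! j)"
      using i by (simp add: B_def A_def v_def scalar_prod_def)
    also have "\<dots> = (\<Sum>t\<in>S. of_int (r (xs ! i) t) * t)"
      by (rule sum.reindex_bij_betw)
         (use xs in \<open>auto simp: N_def atLeast0LessThan intro!: bij_betw_nth\<close>)
    also have "\<dots> = z * xs ! i"
      using r[of "xs ! i"] i xs by (auto simp: N_def)
    finally show "(B *\<^sub>v v) $ i = (z \<cdot>\<^sub>v v) $ i" using i by (simp add: v_def)
  qed (simp_all add: B_def A_def v_def)
  moreover have "v \<noteq> 0\<^sub>v N"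
  proof
    assume v0: "v = 0\<^sub>v N"
    obtain i where i: "i < N" "xs ! i = s0"
      using s0 xs by (auto simp: in_set_conv_nth N_def)
    have "v $ i = 0" using v0 i by simp
    then show False using i s0 by (simp add: v_def)
  qed
  ultimately have "eigenvalue B z"
    using cB cv by (auto simp: eigenvalue_def eigenvector_def)
  then have "poly (char_poly B) z = 0"
    using eigenvalue_root_char_poly[OF cB] by simp
  moreover have "char_poly B = map_poly of_int (char_poly A)"
    unfolding B_def by (rule of_int_hom.char_poly_hom[OF cA])
  moreover have "lead_coeff (char_poly A) = 1"
    using degree_monic_char_poly[OF cA] by simp
  ultimately show ?thesis unfolding algebraic_int_altdef_ipoly by auto
qed

section \<open>Lattices stable under multiplication\<close>

definition int_span :: "'a :: comm_ring_1 set \<Rightarrow> 'a set" where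
  "int_span S = {w. \<exists>r. w = (\<Sum>t\<in>S. of_int (r t) * t)}"

lemma int_span_base: "finite S \<Longrightarrow> s \<in> S \<Longrightarrow> s \<in> int_span S"
  unfolding int_span_def
  by (rule CollectI, rule exI[of _ "\<lambda>t. if t = s then 1 else 0"]) (simp add: if_distrib if_distribR cong: if_cong)

lemma int_span_zero: "0 \<in> int_span S"
  unfolding int_span_def by (rule CollectI, rule exI[of _ "\<lambda>t. 0"]) simp

lemma int_span_add: "a \<in> int_span S \<Longrightarrow> b \<in> int_span S \<Longrightarrow> a + b \<in> int_span S"
  unfolding int_span_def
proof clarify
  fix r r' :: "'a \<Rightarrow> int"
  show "\<exists>r''. (\<Sum>t\<in>S. of_int (r t) * t) + (\<Sum>t\<in>S. of_int (r' t) * t) = (\<Sum>t\<in>S. of_int (r'' t) * t)"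
    by (rule exI[of _ "\<lambda>t. r t + r' t"]) (simp add: sum.distrib algebra_simps)
qed

lemma int_span_smult: "a \<in> int_span S \<Longrightarrow> of_int k * a \<in> int_span S"
  unfolding int_span_def
proof clarify
  fix r :: "'a \<Rightarrow> int"
  show "\<exists>r''. of_int k * (\<Sum>t\<in>S. of_int (r t) * t) = (\<Sum>t\<in>S. of_int (r'' t) * t)"
    by (rule exI[of _ "\<lambda>t. k * r t"]) (simp add: sum_distrib_left algebra_simps)
qed

lemma int_span_sum: "(\<And>i. i \<in> I \<Longrightarrow> f i \<in> int_span S) \<Longrightarrow> sum f I \<in> int_span S"
  by (induction I rule: infinite_finite_induct) (auto simp: int_span_zero int_span_add)

lemma int_span_mult_closed:
  assumes "\<And>s. s \<in> S \<Longrightarrow> x * s \<in> int_span S" and "a \<in> int_span S"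
  shows "x * a \<in> int_span S"
proof -
  obtain r where "a = (\<Sum>t\<in>S. of_int (r t) * t)" using assms by (auto simp: int_span_def)
  then have "x * a = (\<Sum>t\<in>S. of_int (r t) * (x * t))" by (simp add: sum_distrib_left algebra_simps)
  also have "\<dots> \<in> int_span S" by (intro int_span_sum int_span_smult assms)
  finally show ?thesis .
qed

text \<open>A monic polynomial with a root is not constant. The positivity of \<open>k\<close> later
  puts 1 among the lattice generators, as the non-zero element required for an eigenvector.\<close>

lemma monic_root_power:
  fixes x :: "'a :: field_char_0"
  assumes "algebraic_int x"
  obtains k c where "k > 0" "x ^ k = (\<Sum>i<k. of_int (c i) * x ^ i)"
proof -
  obtain p where p: "poly (map_poly of_int p) x = 0" "lead_coeff p = (1 :: int)"
    using assms unfolding algebraic_int_altdef_ipoly by auto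
  define k where "k = degree p"
  have "(\<Sum>i\<le>k. of_int (coeff p i) * x ^ i) = 0"
    using p(1) by (simp add: poly_altdef coeff_map_poly degree_map_poly k_def)
  then have s: "(\<Sum>i<k. of_int (coeff p i) * x ^ i) + x ^ k = 0"
    using p(2) by (simp add: lessThan_Suc_atMost[symmetric] k_def)
  have "k \<noteq> 0" using s by (intro notI) simp
  moreover have "x ^ k = (\<Sum>i<k. of_int (- coeff p i) * x ^ i)"
    using s unfolding eq_neg_iff_add_eq_0[symmetric] add.commute[of _ "x ^ k"] by (simp add: sum_negf)
  ultimately show thesis by (intro that[of k "\<lambda>i. - coeff p i"]) simp_all
qed

text \<open>The lattice is Z[x, y], generated by the monomials below the degrees of the two monic
  relations; a power that reaches its degree is rewritten by its relation. One lattice serves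
  \<open>x\<close> and \<open>y\<close> together, so it is stable under x + y and under x y as
  well.\<close>

lemma algebraic_int_pair_lattice:
  fixes x y :: "'a :: field_char_0"
  assumes "algebraic_int x" "algebraic_int y"
  obtains S where "finite S" "1 \<in> S"
    "\<And>a. a \<in> int_span S \<Longrightarrow> x * a \<in> int_span S" "\<And>a. a \<in> int_span S \<Longrightarrow> y * a \<in> int_span S"
proof -
  obtain k c where k: "k > 0" "x ^ k = (\<Sum>i<k. of_int (c i) * x ^ i)"
    using monic_root_power[OF assms(1)] .
  obtain l e where l: "l > 0" "y ^ l = (\<Sum>i<l. of_int (e i) * y ^ i)"
    using monic_root_power[OF assms(2)] .
  define S where "S = (\<lambda>(i, j). x ^ i * y ^ j) ` ({..<k} \<times> {..<l})"
  have fin: "finite S" by (simp add: S_def)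
  have in_S: "x ^ i * y ^ j \<in> S" if "i < k" "j < l" for i j using that by (auto simp: S_def)
  have in_span: "x ^ i * y ^ j \<in> int_span S" if "i < k" "j < l" for i j
    by (rule int_span_base[OF fin in_S[OF that]])
  have one: "1 \<in> S" using in_S[of 0 0] k l by simp
  have x: "x * s \<in> int_span S" if s: "s \<in> S" for s
  proof -
    obtain i j where ij: "i < k" "j < l" "s = x ^ i * y ^ j" using s by (auto simp: S_def)
    show ?thesis
    proof (cases "Suc i < k")
      case True
      then show ?thesis using in_span[of "Suc i" j] ij(2) by (simp add: ij(3) mult.assoc)
    next
      case False
      then have "Suc i = k" using ij(1) by linarith
      moreover have "x * s = x ^ Suc i * y ^ j" by (simp add: ij(3) mult.assoc)
      ultimately have "x * s = x ^ k * y ^ j" by (simp only:)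
      also have "\<dots> = (\<Sum>i<k. of_int (c i) * (x ^ i * y ^ j))"
        by (simp only: k(2) sum_distrib_right mult.assoc)
      also have "\<dots> \<in> int_span S" using ij(1,2) by (intro int_span_sum int_span_smult in_span) auto
      finally show ?thesis .
    qed
  qed
  have y: "y * s \<in> int_span S" if s: "s \<in> S" for s
  proof -
    obtain i j where ij: "i < k" "j < l" "s = x ^ i * y ^ j" using s by (auto simp: S_def)
    show ?thesis
    proof (cases "Suc j < l")
      case True
      then show ?thesis using in_span[of i "Suc j"] ij(1) by (simp add: ij(3) mult_ac)
    next
      case False
      then have "Suc j = l" using ij(2) by linarith
      moreover have "y * s = x ^ i * y ^ Suc j" by (simp add: ij(3) mult_ac)
      ultimately have "y * s = x ^ i * y ^ l" by (simp only:)
      also have "\<dots> = (\<Sum>j<l. of_int (e j) * (x ^ i * y ^ j))"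
        by (simp only: l(2) sum_distrib_left mult.left_commute)
      also have "\<dots> \<in> int_span S" using ij(1,2) by (intro int_span_sum int_span_smult in_span) auto
      finally show ?thesis .
    qed
  qed
  show thesis
  proof (rule that[OF fin one])
    show "x * a \<in> int_span S" if "a \<in> int_span S" for a
      using x that by (rule int_span_mult_closed)
    show "y * a \<in> int_span S" if "a \<in> int_span S" for a
      using y that by (rule int_span_mult_closed)
  qed
qed

lemma algebraic_int_if_span_stable:
  fixes z :: "'a :: field_char_0"
  assumes "finite S" "1 \<in> S" "\<And>a. a \<in> int_span S \<Longrightarrow> z * a \<in> int_span S"
  shows "algebraic_int z"
proof -
  have "\<forall>s\<in>S. \<exists>r. z * s = (\<Sum>t\<in>S. of_int (r t) * t)"
    using assms(3) int_span_base[OF assms(1)] by (auto simp: int_span_def)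
  then obtain r where "\<And>s. s \<in> S \<Longrightarrow> z * s = (\<Sum>t\<in>S. of_int (r s t) * t)" by metis
  then show ?thesis using algebraic_int_if_lattice_stable[OF assms(1,2)] by simp
qed

lemma algebraic_int_add:
  fixes x y :: "'a :: field_char_0"
  assumes "algebraic_int x" "algebraic_int y"
  shows "algebraic_int (x + y)"
proof -
  obtain S where S: "finite S" "1 \<in> S"
    "\<And>a. a \<in> int_span S \<Longrightarrow> x * a \<in> int_span S" "\<And>a. a \<in> int_span S \<Longrightarrow> y * a \<in> int_span S"
    by (rule algebraic_int_pair_lattice[OF assms]) blast
  show ?thesis
    by (rule algebraic_int_if_span_stable[OF S(1,2)]) (simp add: distrib_right int_span_add S)
qed

lemma algebraic_int_mult:
  fixes x y :: "'a :: field_char_0"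
  assumes "algebraic_int x" "algebraic_int y"
  shows "algebraic_int (x * y)"
proof -
  obtain S where S: "finite S" "1 \<in> S"
    "\<And>a. a \<in> int_span S \<Longrightarrow> x * a \<in> int_span S" "\<And>a. a \<in> int_span S \<Longrightarrow> y * a \<in> int_span S"
    by (rule algebraic_int_pair_lattice[OF assms]) blast
  show ?thesis
    by (rule algebraic_int_if_span_stable[OF S(1,2)]) (simp add: mult.assoc S)
qed

section \<open>Petit algebras over nonassociative rings\<close>

text \<open>The common ground of O_K, its residue rings, D and \<Lambda>: a Petit algebra satisfies
  these laws but in general not associativity.\<close>

locale nonassoc_ring = abelian_group R for R (structure) +
  assumes m_closed [simp]: "x \<in> carrier R \<Longrightarrow> y \<in> carrier R \<Longrightarrow> x \<otimes> y \<in> carrier R"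
    and one_closed [simp]: "\<one> \<in> carrier R"
    and l_distr: "x \<in> carrier R \<Longrightarrow> y \<in> carrier R \<Longrightarrow> z \<in> carrier R \<Longrightarrow> (x \<oplus> y) \<otimes> z = x \<otimes> z \<oplus> y \<otimes> z"
    and r_distr: "x \<in> carrier R \<Longrightarrow> y \<in> carrier R \<Longrightarrow> z \<in> carrier R \<Longrightarrow> z \<otimes> (x \<oplus> y) = z \<otimes> x \<oplus> z \<otimes> y"
    and l_one [simp]: "x \<in> carrier R \<Longrightarrow> \<one> \<otimes> x = x"
    and r_one [simp]: "x \<in> carrier R \<Longrightarrow> x \<otimes> \<one> = x"
begin

lemma l_null [simp]: "x \<in> carrier R \<Longrightarrow> \<zero> \<otimes> x = \<zero>"
  using l_distr[of \<zero> \<zero> x] by simp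

lemma r_null [simp]: "x \<in> carrier R \<Longrightarrow> x \<otimes> \<zero> = \<zero>"
  using r_distr[of \<zero> \<zero> x] by simp

lemma r_minus: "x \<in> carrier R \<Longrightarrow> y \<in> carrier R \<Longrightarrow> x \<otimes> (\<ominus> y) = \<ominus> (x \<otimes> y)"
  using r_distr[of "\<ominus> y" y x] by (simp add: minus_equality l_neg)

lemma foldr_eq_finsum:
  assumes "g \<in> {..<n} \<rightarrow> carrier R" "a \<in> carrier R"
  shows "foldr (\<lambda>i acc. g i \<oplus> acc) [0..<n] a = finsum R g {..<n} \<oplus> a"
  using assms
proof (induction n arbitrary: a)
  case (Suc n)
  then have "finsum R g {..<Suc n} = g n \<oplus> finsum R g {..<n}"
    unfolding lessThan_Suc by (intro finsum_insert) auto
  moreover have "finsum R g {..<n} \<in> carrier R" using Suc.prems by (intro finsum_closed) auto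
  moreover have "g n \<in> carrier R" using Suc.prems by auto
  \<comment> \<open>\<open>[0..<Suc n]\<close> splits at its last index, and \<open>foldr\<close>
    feeds that summand into the accumulator first; this is why the induction runs over arbitrary
    \<open>a\<close>.\<close>
  moreover have "foldr (\<lambda>i acc. g i \<oplus> acc) [0..<n] (g n \<oplus> a) = finsum R g {..<n} \<oplus> (g n \<oplus> a)"
    using Suc.prems by (intro Suc.IH) auto
  ultimately show ?case using Suc.prems(2) by (simp add: a_ac)
qed simp

end

lemma (in ring) is_nonassoc_ring: "nonassoc_ring R"
  by (intro nonassoc_ring.intro nonassoc_ring_axioms.intro abelian_group_axioms)
     (simp_all add: l_distr r_distr)

text \<open>Neither associativity of the base ring nor multiplicativity of the twist enters into division
  with remainder by \<open>t\<^sup>m - d\<close>; so the Petit construction can be iterated without first showing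
  that the natural order is associative.\<close>

locale twisted_ring = nonassoc_ring +
  fixes \<sigma> :: "'a \<Rightarrow> 'a"
  assumes \<sigma>_closed [simp]: "x \<in> carrier R \<Longrightarrow> \<sigma> x \<in> carrier R"
    and \<sigma>_add: "x \<in> carrier R \<Longrightarrow> y \<in> carrier R \<Longrightarrow> \<sigma> (x \<oplus> y) = \<sigma> x \<oplus> \<sigma> y"
    and \<sigma>_one [simp]: "\<sigma> \<one> = \<one>"
begin

lemma \<sigma>_zero [simp]: "\<sigma> \<zero> = \<zero>"
proof -
  have "\<sigma> \<zero> \<oplus> \<sigma> \<zero> = \<sigma> \<zero>" using \<sigma>_add[of \<zero> \<zero>] by simp
  then show ?thesis by simp
qed

lemma \<sigma>_minus: "x \<in> carrier R \<Longrightarrow> \<sigma> (\<ominus> x) = \<ominus> \<sigma> x"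
  using \<sigma>_add[of "\<ominus> x" x] by (simp add: minus_equality l_neg)

lemma \<sigma>_pow_closed [simp]: "x \<in> carrier R \<Longrightarrow> (\<sigma> ^^ i) x \<in> carrier R"
  by (induction i) auto

lemma \<sigma>_pow_add: "x \<in> carrier R \<Longrightarrow> y \<in> carrier R \<Longrightarrow> (\<sigma> ^^ i) (x \<oplus> y) = (\<sigma> ^^ i) x \<oplus> (\<sigma> ^^ i) y"
  by (induction i) (auto simp: \<sigma>_add)

lemma \<sigma>_pow_minus: "x \<in> carrier R \<Longrightarrow> (\<sigma> ^^ i) (\<ominus> x) = \<ominus> (\<sigma> ^^ i) x"
  by (induction i) (auto simp: \<sigma>_minus)

lemma \<sigma>_pow_one [simp]: "(\<sigma> ^^ i) \<one> = \<one>"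
  by (induction i) auto

lemma \<sigma>_pow_zero [simp]: "(\<sigma> ^^ i) \<zero> = \<zero>"
  by (induction i) auto

lemma skew_carrier_closed: "p \<in> skew_carrier R \<Longrightarrow> p i \<in> carrier R"
  by (simp add: skew_carrier_def)

lemma skew_mult_eq_finsum:
  assumes p: "\<And>i. p i \<in> carrier R" and q: "\<And>i. q i \<in> carrier R"
  shows "skew_mult R \<sigma> p q k = (\<Oplus>i\<in>{..k}. p i \<otimes> (\<sigma> ^^ i) (q (k - i)))"
proof -
  let ?g = "\<lambda>i. p i \<otimes> (\<sigma> ^^ i) (q (k - i))"
  have "foldr (\<lambda>i acc. ?g i \<oplus> acc) [0..<Suc k] \<zero> = finsum R ?g {..<Suc k} \<oplus> \<zero>"
    by (rule foldr_eq_finsum) (use p q in auto)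
  moreover have "finsum R ?g {..<Suc k} \<in> carrier R" by (rule finsum_closed) (use p q in auto)
  ultimately show ?thesis unfolding skew_mult_def lessThan_Suc_atMost by (metis r_zero)
qed

lemma skew_mult_closed:
  assumes "p \<in> skew_carrier R" "q \<in> skew_carrier R"
  shows "skew_mult R \<sigma> p q \<in> skew_carrier R"
proof -
  note [simp] = skew_carrier_closed[OF assms(1)] skew_carrier_closed[OF assms(2)]
  have cl: "skew_mult R \<sigma> p q k \<in> carrier R" for k
    unfolding skew_mult_eq_finsum[OF skew_carrier_closed[OF assms(1)] skew_carrier_closed[OF assms(2)]]
    by (rule finsum_closed) (use assms in auto)
  obtain M N where MN: "\<And>i. i \<ge> M \<Longrightarrow> p i = \<zero>" "\<And>i. i \<ge> N \<Longrightarrow> q i = \<zero>"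
    using assms by (auto simp: skew_carrier_def)
  have "skew_mult R \<sigma> p q k = \<zero>" if k: "k \<ge> M + N" for k
  proof -
    have "p i \<otimes> (\<sigma> ^^ i) (q (k - i)) = \<zero>" if "i \<le> k" for i
      using MN(1)[of i] MN(2)[of "k - i"] assms k by (cases "i \<ge> M") auto
    then have "(\<Oplus>i\<in>{..k}. p i \<otimes> (\<sigma> ^^ i) (q (k - i))) = (\<Oplus>i\<in>{..k}. \<zero>)"
      by (intro finsum_cong') auto
    then show ?thesis
      by (simp add: skew_mult_eq_finsum[OF skew_carrier_closed[OF assms(1)] skew_carrier_closed[OF assms(2)]])
  qed
  with cl show ?thesis by (auto simp: skew_carrier_def)
qed

lemma skew_add_closed:
  assumes "p \<in> skew_carrier R" "q \<in> skew_carrier R"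
  shows "skew_add R p q \<in> skew_carrier R"
proof -
  note [simp] = skew_carrier_closed[OF assms(1)] skew_carrier_closed[OF assms(2)]
  obtain M N where MN: "\<And>i. i \<ge> M \<Longrightarrow> p i = \<zero>" "\<And>i. i \<ge> N \<Longrightarrow> q i = \<zero>"
    using assms by (auto simp: skew_carrier_def)
  then have "\<forall>i\<ge>max M N. p i \<oplus> q i = \<zero>" by simp
  then have "\<exists>N. \<forall>i\<ge>N. p i \<oplus> q i = \<zero>" by blast
  then show ?thesis using assms by (simp add: skew_carrier_def skew_add_def)
qed

lemma skew_mult_l_distr:
  assumes "p \<in> skew_carrier R" "q \<in> skew_carrier R" "r \<in> skew_carrier R"
  shows "skew_mult R \<sigma> (skew_add R p q) r = skew_add R (skew_mult R \<sigma> p r) (skew_mult R \<sigma> q r)"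
proof
  note [simp] = skew_carrier_closed[OF assms(1)] skew_carrier_closed[OF assms(2)] skew_carrier_closed[OF assms(3)]
  fix k
  show "skew_mult R \<sigma> (skew_add R p q) r k = skew_add R (skew_mult R \<sigma> p r) (skew_mult R \<sigma> q r) k"
    using assms
    by (simp add: skew_add_def skew_mult_eq_finsum l_distr Pi_def)
qed

lemma skew_mult_r_distr:
  assumes "p \<in> skew_carrier R" "q \<in> skew_carrier R" "r \<in> skew_carrier R"
  shows "skew_mult R \<sigma> r (skew_add R p q) = skew_add R (skew_mult R \<sigma> r p) (skew_mult R \<sigma> r q)"
proof
  note [simp] = skew_carrier_closed[OF assms(1)] skew_carrier_closed[OF assms(2)] skew_carrier_closed[OF assms(3)]
  fix k
  show "skew_mult R \<sigma> r (skew_add R p q) k = skew_add R (skew_mult R \<sigma> r p) (skew_mult R \<sigma> r q) k"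
    using assms
    by (simp add: skew_add_def skew_mult_eq_finsum \<sigma>_pow_add r_distr Pi_def)
qed

lemma skew_mult_cst_left:
  assumes "a \<in> carrier R" "p \<in> skew_carrier R"
  shows "skew_mult R \<sigma> (cst R a) p = (\<lambda>k. a \<otimes> p k)"
proof
  note [simp] = skew_carrier_closed[OF assms(2)]
  fix k
  have "skew_mult R \<sigma> (cst R a) p k = (\<Oplus>i\<in>{..k}. cst R a i \<otimes> (\<sigma> ^^ i) (p (k - i)))"
    by (rule skew_mult_eq_finsum) (use assms in \<open>auto simp: cst_def\<close>)
  also have "\<dots> = (\<Oplus>i\<in>{..k}. if 0 = i then a \<otimes> p k else \<zero>)"
    by (rule finsum_cong') (use assms in \<open>auto simp: cst_def\<close>)
  also have "\<dots> = a \<otimes> p k"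
    by (rule finsum_singleton) (use assms in auto)
  finally show "skew_mult R \<sigma> (cst R a) p k = a \<otimes> p k" .
qed

lemma skew_mult_one_right:
  assumes "p \<in> skew_carrier R"
  shows "skew_mult R \<sigma> p (cst R \<one>) = p"
proof
  note [simp] = skew_carrier_closed[OF assms]
  fix k
  have "skew_mult R \<sigma> p (cst R \<one>) k = (\<Oplus>i\<in>{..k}. p i \<otimes> (\<sigma> ^^ i) (cst R \<one> (k - i)))"
    by (rule skew_mult_eq_finsum) (use assms in \<open>auto simp: cst_def\<close>)
  also have "\<dots> = (\<Oplus>i\<in>{..k}. if k = i then p i else \<zero>)"
    by (rule finsum_cong') (use assms in \<open>auto simp: cst_def\<close>)
  also have "\<dots> = p k"
    by (rule finsum_singleton) (use assms in auto)
  finally show "skew_mult R \<sigma> p (cst R \<one>) k = p k" .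
qed

end

section \<open>Division by t^m - d and the Petit multiplication\<close>

locale petit_tm_data = twisted_ring +
  fixes m :: nat and d :: 'a
  assumes m_pos: "m > 0" and d_closed [simp]: "d \<in> carrier R"
begin

lemma skew_mult_tm_minus:
  assumes "q \<in> skew_carrier R"
  shows "skew_mult R \<sigma> q (tm_minus R m d) k =
    (if k \<ge> m then q (k - m) else \<zero>) \<ominus> q k \<otimes> (\<sigma> ^^ k) d"
proof -
  note [simp] = skew_carrier_closed[OF assms]
  \<comment> \<open>\<open>?u\<close> collects the contribution of t^m and \<open>?v\<close> that of
    -d. For k < m the truncated difference k - m is 0, so the inner conditional in \<open>?u\<close>
    must cancel a spurious term at index 0. Since m > 0, the two contributions come from different
    indices.\<close>
  let ?u = "\<lambda>i. if k - m = i then (if k \<ge> m then q (k - m) else \<zero>) else \<zero>"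
  let ?v = "\<lambda>i. if k = i then \<ominus> (q k \<otimes> (\<sigma> ^^ k) d) else \<zero>"
  have "skew_mult R \<sigma> q (tm_minus R m d) k = (\<Oplus>i\<in>{..k}. q i \<otimes> (\<sigma> ^^ i) (tm_minus R m d (k - i)))"
    by (rule skew_mult_eq_finsum) (use assms in \<open>auto simp: tm_minus_def\<close>)
  also have "\<dots> = (\<Oplus>i\<in>{..k}. ?u i \<oplus> ?v i)"
  proof (rule finsum_cong')
    fix i assume "i \<in> {..k}"
    then consider "i = k" | "i < k" "i + m = k" | "i < k" "i + m \<noteq> k" by fastforce
    then show "q i \<otimes> (\<sigma> ^^ i) (tm_minus R m d (k - i)) = ?u i \<oplus> ?v i"
      using assms m_pos by cases (auto simp: tm_minus_def \<sigma>_pow_minus r_minus)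
  qed (use assms in auto)
  also have "\<dots> = (\<Oplus>i\<in>{..k}. ?u i) \<oplus> (\<Oplus>i\<in>{..k}. ?v i)"
    by (rule finsum_addf) (use assms in auto)
  also have "(\<Oplus>i\<in>{..k}. ?u i) = (if k \<ge> m then q (k - m) else \<zero>)"
    by (rule finsum_singleton) (use assms in auto)
  also have "(\<Oplus>i\<in>{..k}. ?v i) = \<ominus> (q k \<otimes> (\<sigma> ^^ k) d)"
    by (rule finsum_singleton) (use assms in auto)
  finally show ?thesis by (simp add: minus_eq)
qed

text \<open>Division with remainder by \<open>t\<^sup>m - d\<close>, read off coefficientwise: the first equation determines
  the quotient \<open>q\<close> from the top down.\<close>

definition division :: "(nat \<Rightarrow> 'a) \<Rightarrow> (nat \<Rightarrow> 'a) \<Rightarrow> (nat \<Rightarrow> 'a) \<Rightarrow> bool" where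
  "division g q r \<longleftrightarrow> q \<in> skew_carrier R \<and> r \<in> skew_carrier R \<and>
     (\<forall>j. q j = g (j + m) \<oplus> q (j + m) \<otimes> (\<sigma> ^^ (j + m)) d) \<and>
     (\<forall>k. r k = (if k < m then g k \<oplus> q k \<otimes> (\<sigma> ^^ k) d else \<zero>))"

lemma divisionD:
  assumes "division g q r"
  shows "q \<in> skew_carrier R" "r \<in> skew_carrier R"
    and "q j = g (j + m) \<oplus> q (j + m) \<otimes> (\<sigma> ^^ (j + m)) d"
    and "r k = (if k < m then g k \<oplus> q k \<otimes> (\<sigma> ^^ k) d else \<zero>)"
  using assms unfolding division_def by blast+

text \<open>Comparing coefficients of t^k: for k \<ge> m the remainder vanishes and the equation
  yields q (k - m), for k < m it yields r k. This connects the recursion with the description by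
  which \<open>rem_r\<close> is defined.\<close>

lemma division_iff:
  assumes "g \<in> skew_carrier R" "q \<in> skew_carrier R" "r \<in> skew_carrier R"
  shows "division g q r \<longleftrightarrow>
    (\<forall>i\<ge>m. r i = \<zero>) \<and> g = skew_add R (skew_mult R \<sigma> q (tm_minus R m d)) r"
proof -
  note [simp] = skew_carrier_closed[OF assms(1)] skew_carrier_closed[OF assms(2)] skew_carrier_closed[OF assms(3)]
  have eq: "x = a \<ominus> b \<oplus> c \<longleftrightarrow> a \<oplus> c = x \<oplus> b"
    if "x \<in> carrier R" "a \<in> carrier R" "b \<in> carrier R" "c \<in> carrier R" for x a b c
  proof
    assume "x = a \<ominus> b \<oplus> c"
    then have "x \<oplus> b = (a \<oplus> c) \<oplus> (\<ominus> b \<oplus> b)" using that by (simp add: minus_eq a_ac)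
    then show "a \<oplus> c = x \<oplus> b" using that by (simp add: l_neg)
  next
    assume h: "a \<oplus> c = x \<oplus> b"
    have "a \<ominus> b \<oplus> c = (a \<oplus> c) \<oplus> \<ominus> b" using that by (simp add: minus_eq a_ac)
    also have "\<dots> = x \<oplus> (b \<oplus> \<ominus> b)" using that by (simp add: h a_assoc)
    finally show "x = a \<ominus> b \<oplus> c" using that by (simp add: r_neg)
  qed
  let ?s = "\<lambda>k. q k \<otimes> (\<sigma> ^^ k) d"
  have "g = skew_add R (skew_mult R \<sigma> q (tm_minus R m d)) r \<longleftrightarrow>
      (\<forall>k. (if k \<ge> m then q (k - m) else \<zero>) \<oplus> r k = g k \<oplus> ?s k)"
    unfolding fun_eq_iff skew_add_def skew_mult_tm_minus[OF assms(2)]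
    by (intro all_cong1 eq) (use assms in auto)
  moreover have "(\<forall>k. (if k \<ge> m then q (k - m) else \<zero>) \<oplus> r k = g k \<oplus> ?s k) \<longleftrightarrow>
      (\<forall>j. q j = g (j + m) \<oplus> ?s (j + m)) \<and> (\<forall>k<m. r k = g k \<oplus> ?s k)"
    if r: "\<forall>i\<ge>m. r i = \<zero>"
  proof (intro iffI conjI allI impI)
    fix j assume "\<forall>k. (if k \<ge> m then q (k - m) else \<zero>) \<oplus> r k = g k \<oplus> ?s k"
    from spec[OF this, of "j + m"] show "q j = g (j + m) \<oplus> ?s (j + m)" using r assms by simp
  next
    fix k assume h: "\<forall>k. (if k \<ge> m then q (k - m) else \<zero>) \<oplus> r k = g k \<oplus> ?s k" and "k < m"
    then show "r k = g k \<oplus> ?s k" using spec[OF h, of k] by simp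
  next
    fix k assume h: "(\<forall>j. q j = g (j + m) \<oplus> ?s (j + m)) \<and> (\<forall>k<m. r k = g k \<oplus> ?s k)"
    show "(if k \<ge> m then q (k - m) else \<zero>) \<oplus> r k = g k \<oplus> ?s k"
    proof (cases "k \<ge> m")
      case True
      have e: "k - m + m = k" using True by simp
      have "q (k - m) = g k \<oplus> ?s k" using h[THEN conjunct1, THEN spec, of "k - m"] unfolding e .
      moreover have "r k = \<zero>" using r True by blast
      ultimately show ?thesis using True by (simp only: if_True) simp
    next
      case False
      then have "r k = g k \<oplus> ?s k" using h by (meson not_le)
      then show ?thesis using False by simp
    qed
  qed
  moreover have "(\<forall>k. r k = (if k < m then g k \<oplus> ?s k else \<zero>)) \<longleftrightarrow>
      (\<forall>i\<ge>m. r i = \<zero>) \<and> (\<forall>k<m. r k = g k \<oplus> ?s k)"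
    by (metis not_le)
  ultimately show ?thesis unfolding division_def using assms by blast
qed

lemma division_ex:
  assumes "g \<in> skew_carrier R"
  obtains q r where "division g q r"
proof -
  note [simp] = skew_carrier_closed[OF assms]
  obtain N where N: "\<And>i. i \<ge> N \<Longrightarrow> g i = \<zero>" using assms by (auto simp: skew_carrier_def)
  define rec where "rec = (\<lambda>q j. q j = g (j + m) \<oplus> q (j + m) \<otimes> (\<sigma> ^^ (j + m)) d)"
  \<comment> \<open>The zero sequence solves the recursion from \<open>N\<close> on, where
    \<open>g\<close> vanishes. Each induction step makes the recursion valid at one more index
    further down, without enlarging the support beyond \<open>N\<close>.\<close>
  have "\<exists>q. (\<forall>j. q j \<in> carrier R) \<and> (\<forall>j\<ge>N. q j = \<zero>) \<and> (\<forall>j. j + n \<ge> N \<longrightarrow> rec q j)" for n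
  proof (induction n)
    case 0
    have "rec (\<lambda>_. \<zero>) j" if "j \<ge> N" for j using N[of "j + m"] that by (simp add: rec_def)
    then show ?case by (intro exI[of _ "\<lambda>_. \<zero>"]) simp
  next
    case (Suc n)
    then obtain q where q: "\<And>j. q j \<in> carrier R" "\<And>j. j \<ge> N \<Longrightarrow> q j = \<zero>"
      "\<And>j. j + n \<ge> N \<Longrightarrow> rec q j" by blast
    show ?case
    proof (cases "n < N")
      case False
      then show ?thesis using q by (intro exI[of _ q]) simp
    next
      case True
      define i where "i = N - Suc n"
      \<comment> \<open>The equations already solved involve only indices above \<open>i\<close>, so
        the change at \<open>i\<close> leaves them intact; m > 0 keeps the new value from referring
        to itself.\<close>
      define q' where "q' = q(i := g (i + m) \<oplus> q (i + m) \<otimes> (\<sigma> ^^ (i + m)) d)"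
      have "rec q' j" if "j + Suc n \<ge> N" for j
      proof (cases "j = i")
        case True
        then show ?thesis using m_pos by (simp add: rec_def q'_def)
      next
        case False
        then have "j > i" "j + n \<ge> N" using that \<open>n < N\<close> by (auto simp: i_def)
        then show ?thesis using q(3)[of j] unfolding rec_def q'_def by simp
      qed
      moreover have "q' j \<in> carrier R" for j using q(1) by (simp add: q'_def)
      moreover have "q' j = \<zero>" if "j \<ge> N" for j using q(2)[OF that] that True by (auto simp: i_def q'_def)
      ultimately show ?thesis by blast
    qed
  qed
  from this[of N] obtain q where q: "\<And>j. q j \<in> carrier R" "\<And>j. j \<ge> N \<Longrightarrow> q j = \<zero>" "\<And>j. rec q j"
    by auto
  define r where "r = (\<lambda>k. if k < m then g k \<oplus> q k \<otimes> (\<sigma> ^^ k) d else \<zero>)"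
  have "r k \<in> carrier R" for k using q(1) by (simp add: r_def)
  moreover have "\<forall>k\<ge>m. r k = \<zero>" by (simp add: r_def)
  ultimately have "r \<in> skew_carrier R" unfolding skew_carrier_def by blast
  moreover have "q \<in> skew_carrier R" unfolding skew_carrier_def using q(1,2) by blast
  ultimately have "division g q r"
    unfolding division_def r_def using q(3)[unfolded rec_def] by (intro conjI allI) (assumption | rule refl)+
  then show thesis by (rule that)
qed

lemma division_unique:
  assumes "division g q r" "division g q' r'"
  shows "q = q'" "r = r'"
proof -
  note D = assms[THEN divisionD(3)] and D' = assms[THEN divisionD(4)]
  obtain M where M: "\<And>i. i \<ge> M \<Longrightarrow> q i = \<zero>"
    using divisionD(1)[OF assms(1)] by (auto simp: skew_carrier_def)
  obtain N where N: "\<And>i. i \<ge> N \<Longrightarrow> q' i = \<zero>"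
    using divisionD(1)[OF assms(2)] by (auto simp: skew_carrier_def)
  have "q j = q' j" for j
  \<comment> \<open>Both quotients vanish from M + N on. The recursion expresses the value at j
    through the one at j + m, which is nearer to that bound.\<close>
  proof (induction "M + N - j" arbitrary: j rule: less_induct)
    case less
    show ?case
    proof (cases "j \<ge> M + N")
      case True
      then show ?thesis using M[of j] N[of j] by simp
    next
      case False
      then have "q (j + m) = q' (j + m)" using m_pos by (intro less) auto
      then show ?thesis using D[of j] by (simp only:)
    qed
  qed
  then show q: "q = q'" ..
  show "r = r'" by (rule ext) (simp only: D' q)
qed

lemma rem_r_eqI:
  assumes "g \<in> skew_carrier R" "division g q r"
  shows "rem_r R \<sigma> m (tm_minus R m d) g = r"
  unfolding rem_r_def
proof (rule the_equality)
  have "q \<in> skew_carrier R" "r \<in> skew_carrier R" using divisionD[OF assms(2)] by blast+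
  then show "r \<in> skew_carrier R \<and> (\<forall>i\<ge>m. r i = \<zero>) \<and>
      (\<exists>q\<in>skew_carrier R. g = skew_add R (skew_mult R \<sigma> q (tm_minus R m d)) r)"
    using assms division_iff by blast
next
  fix r' assume "r' \<in> skew_carrier R \<and> (\<forall>i\<ge>m. r' i = \<zero>) \<and>
      (\<exists>q\<in>skew_carrier R. g = skew_add R (skew_mult R \<sigma> q (tm_minus R m d)) r')"
  then obtain q' where "division g q' r'" using assms(1) division_iff by blast
  then show "r' = r" using division_unique(2)[OF assms(2)] by simp
qed

abbreviation "P \<equiv> petit_tm R \<sigma> m d"

lemma P_simps:
  "carrier P = {p \<in> skew_carrier R. \<forall>i\<ge>m. p i = \<zero>}"
  "x \<otimes>\<^bsub>P\<^esub> y = rem_r R \<sigma> m (tm_minus R m d) (skew_mult R \<sigma> x y)"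
  "\<one>\<^bsub>P\<^esub> = cst R \<one>" "\<zero>\<^bsub>P\<^esub> = (\<lambda>i. \<zero>)" "x \<oplus>\<^bsub>P\<^esub> y = skew_add R x y"
  by (simp_all add: petit_tm_def petit_def)

lemma carrier_P_iff: "p \<in> carrier P \<longleftrightarrow> (\<forall>i. p i \<in> carrier R) \<and> (\<forall>i\<ge>m. p i = \<zero>)"
  unfolding P_simps skew_carrier_def by auto

lemma carrier_P_skew [simp]: "p \<in> carrier P \<Longrightarrow> p \<in> skew_carrier R"
  by (simp add: P_simps)

lemma rem_r_id:
  assumes "p \<in> carrier P"
  shows "rem_r R \<sigma> m (tm_minus R m d) p = p"
proof (rule rem_r_eqI[where q = "\<lambda>_. \<zero>"])
  show "division p (\<lambda>_. \<zero>) p"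
    using assms by (auto simp: division_def carrier_P_iff skew_carrier_def)
qed (use assms in simp)

text \<open>The recursion is linear in (g, q, r), so two divisions add up to the division of the
  sum. With the distributivity of skew multiplication this gives distributivity of the Petit
  multiplication.\<close>

lemma rem_r_add:
  assumes "g \<in> skew_carrier R" "h \<in> skew_carrier R"
  shows "rem_r R \<sigma> m (tm_minus R m d) (skew_add R g h) =
    skew_add R (rem_r R \<sigma> m (tm_minus R m d) g) (rem_r R \<sigma> m (tm_minus R m d) h)"
proof -
  obtain q r where D: "division g q r" using division_ex[OF assms(1)] .
  obtain q' r' where D': "division h q' r'" using division_ex[OF assms(2)] .
  note E = divisionD[OF D] divisionD[OF D']
  have c [simp]: "q i \<in> carrier R" "q' i \<in> carrier R" "g i \<in> carrier R" "h i \<in> carrier R" for i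
    using E(1,2,5,6) assms skew_carrier_closed by blast+
  have key: "(g i \<oplus> q i \<otimes> s) \<oplus> (h i \<oplus> q' i \<otimes> s) = (g i \<oplus> h i) \<oplus> (q i \<oplus> q' i) \<otimes> s"
    if "s \<in> carrier R" for i s
    using that by (simp add: l_distr a_ac)
  have "division (skew_add R g h) (skew_add R q q') (skew_add R r r')"
    unfolding division_def
  proof (intro conjI allI)
    fix j
    have "q j \<oplus> q' j = (g (j + m) \<oplus> q (j + m) \<otimes> (\<sigma> ^^ (j + m)) d) \<oplus>
        (h (j + m) \<oplus> q' (j + m) \<otimes> (\<sigma> ^^ (j + m)) d)"
      using E(3,7) by metis
    then show "skew_add R q q' j = skew_add R g h (j + m) \<oplus> skew_add R q q' (j + m) \<otimes> (\<sigma> ^^ (j + m)) d"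
      by (simp only: skew_add_def key[OF \<sigma>_pow_closed[OF d_closed]])
    show "skew_add R r r' j =
        (if j < m then skew_add R g h j \<oplus> skew_add R q q' j \<otimes> (\<sigma> ^^ j) d else \<zero>)"
      unfolding E(4,8) skew_add_def by (simp add: key)
  qed (use E(1,2,5,6) in \<open>auto intro: skew_add_closed\<close>)
  then have "rem_r R \<sigma> m (tm_minus R m d) (skew_add R g h) = skew_add R r r'"
    by (rule rem_r_eqI[OF skew_add_closed[OF assms]])
  then show ?thesis using rem_r_eqI[OF assms(1) D] rem_r_eqI[OF assms(2) D'] by simp
qed

lemma rem_r_closed:
  assumes "g \<in> skew_carrier R"
  shows "rem_r R \<sigma> m (tm_minus R m d) g \<in> carrier P"
proof -
  obtain q r where D: "division g q r" using division_ex[OF assms] .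
  have "r k = \<zero>" if "k \<ge> m" for k
    unfolding divisionD(4)[OF D, of k] using that by simp
  then show ?thesis
    unfolding P_simps(1) rem_r_eqI[OF assms D] using divisionD(2)[OF D] by blast
qed

text \<open>A constant on the left does not raise the degree, so nothing is reduced modulo t^m - d.
  This is what makes subgroups generated by scalar multiples visible on coefficients.\<close>

lemma petit_scalar_mult:
  assumes "a \<in> carrier R" "p \<in> carrier P"
  shows "cst R a \<otimes>\<^bsub>P\<^esub> p = (\<lambda>k. a \<otimes> p k)"
proof -
  have "(\<lambda>k. a \<otimes> p k) \<in> carrier P" using assms by (auto simp: carrier_P_iff)
  then show ?thesis using assms by (simp add: P_simps(2) skew_mult_cst_left rem_r_id)
qed

lemma petit_abelian_group: "abelian_group P"
proof (rule abelian_groupI)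
  fix x assume x: "x \<in> carrier P"
  show "\<exists>y\<in>carrier P. y \<oplus>\<^bsub>P\<^esub> x = \<zero>\<^bsub>P\<^esub>"
    by (rule bexI[of _ "\<lambda>i. \<ominus> x i"])
       (use x in \<open>auto simp: P_simps(4,5) skew_add_def carrier_P_iff l_neg\<close>)
qed (auto simp: P_simps(4,5) skew_add_def carrier_P_iff a_ac)

lemma petit_minus:
  assumes "x \<in> carrier P"
  shows "\<ominus>\<^bsub>P\<^esub> x = (\<lambda>i. \<ominus> x i)"
proof -
  interpret P: abelian_group P by (rule petit_abelian_group)
  show ?thesis
    by (rule P.minus_equality)
       (use assms in \<open>auto simp: P_simps(4,5) skew_add_def carrier_P_iff l_neg\<close>)
qed

lemma petit_nonassoc_ring: "nonassoc_ring P"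
proof (intro nonassoc_ring.intro petit_abelian_group nonassoc_ring_axioms.intro)
  show one: "\<one>\<^bsub>P\<^esub> \<in> carrier P" using m_pos by (auto simp: carrier_P_iff P_simps(3) cst_def)
  fix x assume x: "x \<in> carrier P"
  show "\<one>\<^bsub>P\<^esub> \<otimes>\<^bsub>P\<^esub> x = x"
    unfolding P_simps(3) using petit_scalar_mult[OF one_closed x] x by (auto simp: carrier_P_iff)
  show "x \<otimes>\<^bsub>P\<^esub> \<one>\<^bsub>P\<^esub> = x"
    using x by (simp add: P_simps(2,3) skew_mult_one_right rem_r_id)
  fix y assume y: "y \<in> carrier P"
  show "x \<otimes>\<^bsub>P\<^esub> y \<in> carrier P"
    using x y by (simp add: P_simps(2) rem_r_closed skew_mult_closed)
  fix z assume z: "z \<in> carrier P"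
  show "(x \<oplus>\<^bsub>P\<^esub> y) \<otimes>\<^bsub>P\<^esub> z = x \<otimes>\<^bsub>P\<^esub> z \<oplus>\<^bsub>P\<^esub> y \<otimes>\<^bsub>P\<^esub> z"
    using x y z by (simp add: P_simps(2,5) skew_mult_l_distr rem_r_add skew_mult_closed)
  show "z \<otimes>\<^bsub>P\<^esub> (x \<oplus>\<^bsub>P\<^esub> y) = z \<otimes>\<^bsub>P\<^esub> x \<oplus>\<^bsub>P\<^esub> z \<otimes>\<^bsub>P\<^esub> y"
    using x y z by (simp add: P_simps(2,5) skew_mult_r_distr rem_r_add skew_mult_closed)
qed

end

text \<open>Closes the construction under iteration: D with the coefficientwise \<sigma> is again an
  admissible base, and \<Lambda> is formed over it.\<close>

lemma (in petit_tm_data) petit_twisted_ring: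
  assumes "twisted_ring R \<tau>"
  shows "twisted_ring P (coeffwise \<tau>)"
proof -
  interpret \<tau>: twisted_ring R \<tau> by fact
  show ?thesis
    by (intro twisted_ring.intro twisted_ring_axioms.intro petit_nonassoc_ring)
       (auto simp: carrier_P_iff P_simps(3,5) coeffwise_def skew_add_def cst_def \<tau>.\<sigma>_add)
qed

section \<open>Functoriality of the Petit construction\<close>

lemma ring_hom_finsum:
  assumes "nonassoc_ring R" "nonassoc_ring S" and \<phi>: "\<phi> \<in> ring_hom R S" and "finite A" "g \<in> A \<rightarrow> carrier R"
  shows "\<phi> (finsum R g A) = finsum S (\<lambda>x. \<phi> (g x)) A"
proof -
  interpret R: nonassoc_ring R by fact
  interpret S: nonassoc_ring S by fact
  show ?thesis using assms(4,5)
  proof (induction A)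
    case empty
    have "\<phi> \<zero>\<^bsub>R\<^esub> \<oplus>\<^bsub>S\<^esub> \<phi> \<zero>\<^bsub>R\<^esub> = \<phi> \<zero>\<^bsub>R\<^esub>"
      using ring_hom_add[OF \<phi>, of "\<zero>\<^bsub>R\<^esub>" "\<zero>\<^bsub>R\<^esub>"] by simp
    then show ?case using ring_hom_closed[OF \<phi>, of "\<zero>\<^bsub>R\<^esub>"] by simp
  next
    case (insert x A)
    then have "finsum R g (insert x A) = g x \<oplus>\<^bsub>R\<^esub> finsum R g A"
      by (intro R.finsum_insert) auto
    moreover have "finsum S (\<lambda>x. \<phi> (g x)) (insert x A) = \<phi> (g x) \<oplus>\<^bsub>S\<^esub> finsum S (\<lambda>x. \<phi> (g x)) A"
      using insert ring_hom_closed[OF \<phi>] by (intro S.finsum_insert) (auto simp: Pi_iff)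
    moreover have "finsum R g A \<in> carrier R" using insert by (intro R.finsum_closed) auto
    ultimately show ?case using insert ring_hom_add[OF \<phi>] by (auto simp: Pi_iff)
  qed
qed

lemma ring_hom_zero':
  assumes "nonassoc_ring R" "nonassoc_ring S" "\<phi> \<in> ring_hom R S"
  shows "\<phi> \<zero>\<^bsub>R\<^esub> = \<zero>\<^bsub>S\<^esub>"
proof -
  interpret R: nonassoc_ring R by fact
  interpret S: nonassoc_ring S by fact
  show ?thesis using ring_hom_finsum[OF assms, of "{}" "\<lambda>_. \<zero>\<^bsub>R\<^esub>"] by simp
qed

text \<open>Applying \<open>\<phi>\<close> to quotient and remainder turns a solution of the
  recursion over \<open>R\<close> into one over \<open>S\<close>. The map is left general because
  the lemma is used twice: for the residue map of O_K, and then for the map between the algebras D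
  that results from it.\<close>

lemma petit_map_hom:
  assumes P: "petit_tm_data R \<sigma> m d" and Q: "petit_tm_data S \<tau> m e"
    and \<phi>: "\<phi> \<in> ring_hom R S"
    and comm: "\<And>x. x \<in> carrier R \<Longrightarrow> \<phi> (\<sigma> x) = \<tau> (\<phi> x)" and d: "\<phi> d = e"
  shows "(\<lambda>p i. \<phi> (p i)) \<in> ring_hom (petit_tm R \<sigma> m d) (petit_tm S \<tau> m e)"
proof -
  interpret P: petit_tm_data R \<sigma> m d by fact
  interpret Q: petit_tm_data S \<tau> m e by fact
  note RS = P.nonassoc_ring_axioms Q.nonassoc_ring_axioms
  have zero [simp]: "\<phi> \<zero>\<^bsub>R\<^esub> = \<zero>\<^bsub>S\<^esub>" by (rule ring_hom_zero'[OF RS \<phi>])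
  have closed [simp]: "\<phi> x \<in> carrier S" if "x \<in> carrier R" for x
    using ring_hom_closed[OF \<phi> that] .
  have pow: "\<phi> ((\<sigma> ^^ i) x) = (\<tau> ^^ i) (\<phi> x)" if "x \<in> carrier R" for i x
    by (induction i) (auto simp: comm that)
  have skew: "(\<lambda>i. \<phi> (p i)) \<in> skew_carrier S" if "p \<in> skew_carrier R" for p
  proof -
    obtain N where "\<And>i. i \<ge> N \<Longrightarrow> p i = \<zero>\<^bsub>R\<^esub>" using \<open>p \<in> skew_carrier R\<close> by (auto simp: skew_carrier_def)
    then have "\<exists>N. \<forall>i\<ge>N. \<phi> (p i) = \<zero>\<^bsub>S\<^esub>" by (intro exI[of _ N]) simp
    then show ?thesis using P.skew_carrier_closed[OF that] by (simp add: skew_carrier_def)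
  qed
  have mult: "(\<lambda>k. \<phi> (skew_mult R \<sigma> p q k)) = skew_mult S \<tau> (\<lambda>i. \<phi> (p i)) (\<lambda>i. \<phi> (q i))"
    if pq: "p \<in> skew_carrier R" "q \<in> skew_carrier R" for p q
  proof
    fix k
    note [simp] = P.skew_carrier_closed[OF pq(1)] P.skew_carrier_closed[OF pq(2)]
    have "\<phi> (skew_mult R \<sigma> p q k) = (\<Oplus>\<^bsub>S\<^esub>i\<in>{..k}. \<phi> (p i \<otimes>\<^bsub>R\<^esub> (\<sigma> ^^ i) (q (k - i))))"
      by (subst P.skew_mult_eq_finsum) (auto intro!: ring_hom_finsum[OF RS \<phi>])
    also have "\<dots> = (\<Oplus>\<^bsub>S\<^esub>i\<in>{..k}. \<phi> (p i) \<otimes>\<^bsub>S\<^esub> (\<tau> ^^ i) (\<phi> (q (k - i))))"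
      by (rule Q.finsum_cong') (auto simp: ring_hom_mult[OF \<phi>] pow)
    also have "\<dots> = skew_mult S \<tau> (\<lambda>i. \<phi> (p i)) (\<lambda>i. \<phi> (q i)) k"
      by (rule Q.skew_mult_eq_finsum[symmetric]) auto
    finally show "\<phi> (skew_mult R \<sigma> p q k) = \<dots>" .
  qed
  have rem: "(\<lambda>k. \<phi> (rem_r R \<sigma> m (tm_minus R m d) g k)) = rem_r S \<tau> m (tm_minus S m e) (\<lambda>k. \<phi> (g k))"
    if g: "g \<in> skew_carrier R" for g
  proof -
    obtain q r where D: "P.division g q r" using P.division_ex[OF g] .
    note E = P.divisionD[OF D]
    note [simp] = P.skew_carrier_closed[OF g] P.skew_carrier_closed[OF E(1)]
    have hom: "\<phi> (g i \<oplus>\<^bsub>R\<^esub> q i \<otimes>\<^bsub>R\<^esub> (\<sigma> ^^ i) d) = \<phi> (g i) \<oplus>\<^bsub>S\<^esub> \<phi> (q i) \<otimes>\<^bsub>S\<^esub> (\<tau> ^^ i) e" for i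
      by (simp add: ring_hom_add[OF \<phi>] ring_hom_mult[OF \<phi>] pow d)
    have "Q.division (\<lambda>k. \<phi> (g k)) (\<lambda>k. \<phi> (q k)) (\<lambda>k. \<phi> (r k))"
      unfolding Q.division_def
    proof (intro conjI allI skew E(1,2))
      fix j
      show "\<phi> (q j) = \<phi> (g (j + m)) \<oplus>\<^bsub>S\<^esub> \<phi> (q (j + m)) \<otimes>\<^bsub>S\<^esub> (\<tau> ^^ (j + m)) e"
        by (subst E(3)) (rule hom)
      show "\<phi> (r j) = (if j < m then \<phi> (g j) \<oplus>\<^bsub>S\<^esub> \<phi> (q j) \<otimes>\<^bsub>S\<^esub> (\<tau> ^^ j) e else \<zero>\<^bsub>S\<^esub>)"
        by (subst E(4)) (simp add: hom)
    qed
    then show ?thesis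
      using Q.rem_r_eqI[OF skew[OF g]] P.rem_r_eqI[OF g D] by simp
  qed
  show ?thesis
  proof (rule ring_hom_memI)
    fix x assume x: "x \<in> carrier P.P"
    then show "(\<lambda>i. \<phi> (x i)) \<in> carrier Q.P" by (auto simp: P.carrier_P_iff Q.carrier_P_iff)
    fix y assume y: "y \<in> carrier P.P"
    show "(\<lambda>i. \<phi> ((x \<otimes>\<^bsub>P.P\<^esub> y) i)) = (\<lambda>i. \<phi> (x i)) \<otimes>\<^bsub>Q.P\<^esub> (\<lambda>i. \<phi> (y i))"
      using x y by (simp add: P.P_simps(2) Q.P_simps(2) rem P.skew_mult_closed mult)
    show "(\<lambda>i. \<phi> ((x \<oplus>\<^bsub>P.P\<^esub> y) i)) = (\<lambda>i. \<phi> (x i)) \<oplus>\<^bsub>Q.P\<^esub> (\<lambda>i. \<phi> (y i))"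
      using x y by (simp add: P.P_simps(5) Q.P_simps(5) skew_add_def ring_hom_add[OF \<phi>] P.carrier_P_iff)
  next
    show "(\<lambda>i. \<phi> (\<one>\<^bsub>P.P\<^esub> i)) = \<one>\<^bsub>Q.P\<^esub>"
      using ring_hom_one[OF \<phi>] by (auto simp: P.P_simps(3) Q.P_simps(3) cst_def)
  qed
qed

section \<open>Subgroups generated by scalar multiples, and quotients by them\<close>

lemma (in nonassoc_ring) scalar_ext_subset:
  assumes "\<And>a. a \<in> I \<Longrightarrow> \<iota> a \<in> carrier R"
  shows "scalar_ext R \<iota> I \<subseteq> carrier R"
proof
  fix x assume "x \<in> scalar_ext R \<iota> I"
  then show "x \<in> carrier R" by induction (auto simp: assms)
qed

lemma (in nonassoc_ring) scalar_ext_add: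
  assumes \<iota>: "\<And>a. a \<in> I \<Longrightarrow> \<iota> a \<in> carrier R"
    and "x \<in> scalar_ext R \<iota> I" and y: "y \<in> scalar_ext R \<iota> I"
  shows "x \<oplus> y \<in> scalar_ext R \<iota> I"
proof -
  have sub: "scalar_ext R \<iota> I \<subseteq> carrier R" by (rule scalar_ext_subset) (rule \<iota>)
  note yR = subsetD[OF sub y]
  from assms(2) show ?thesis
  proof induction
    case zero
    then show ?case using y yR by simp
  next
    case (step a x z)
    have "z \<in> carrier R" using subsetD[OF sub step.hyps(3)] .
    then have "\<iota> a \<otimes> x \<oplus> z \<oplus> y = \<iota> a \<otimes> x \<oplus> (z \<oplus> y)"
      using yR step.hyps(2) \<iota>[OF step.hyps(1)] by (simp add: a_assoc)
    then show ?case using scalar_ext.step[OF step.hyps(1,2) step.IH] by simp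
  qed
qed

text \<open>Scalars act on each coefficient separately, which gives one inclusion; for the other, an
  element is the sum of its monomials. The embedding \<open>\<iota>\<close> is a parameter so that
  the lemma can be iterated: it is the identity when passing from O_K to D, and the inclusion of
  constants when passing from D to \<Lambda>.\<close>

lemma (in petit_tm_data) scalar_ext_petit:
  assumes \<iota>: "\<And>a. a \<in> I \<Longrightarrow> \<iota> a \<in> carrier R"
  shows "scalar_ext P (\<lambda>a. cst R (\<iota> a)) I = {p \<in> carrier P. \<forall>i. p i \<in> scalar_ext R \<iota> I}"
proof -
  interpret P: nonassoc_ring P by (rule petit_nonassoc_ring)
  let ?J = "scalar_ext R \<iota> I" and ?JP = "scalar_ext P (\<lambda>a. cst R (\<iota> a)) I"
  have cst: "cst R (\<iota> a) \<in> carrier P" if "a \<in> I" for a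
    using \<iota>[OF that] m_pos by (auto simp: carrier_P_iff cst_def)
  have "p i \<in> ?J" if "p \<in> ?JP" for p i
    using that
  proof induction
    case zero
    then show ?case by (simp add: P_simps(4) scalar_ext.zero)
  next
    case (step a x y)
    then show ?case
      by (simp add: petit_scalar_mult \<iota> P_simps(5) skew_add_def scalar_ext.step carrier_P_iff)
  qed
  moreover have "p \<in> ?JP" if p: "p \<in> carrier P" "\<forall>i. p i \<in> ?J" for p
  proof -
    \<comment> \<open>For n < m the monomial x t^n already lies in \<open>P\<close>, so each step
      generating \<open>y\<close> in the base ring can be copied in degree n. The truncations of
      \<open>p\<close> below then add up its monomials one at a time.\<close>
    have mono: "(\<lambda>i. if i = n then y else \<zero>) \<in> ?JP" if "y \<in> ?J" "n < m" for n y
      using that(1)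
    proof induction
      case zero
      then show ?case using scalar_ext.zero[of P] by (simp add: P_simps(4))
    next
      case (step a x y)
      let ?x = "\<lambda>i. if i = n then x else \<zero>"
      have x: "?x \<in> carrier P" using step \<open>n < m\<close> by (auto simp: carrier_P_iff)
      have "(\<lambda>i. if i = n then \<iota> a \<otimes> x \<oplus> y else \<zero>) =
          cst R (\<iota> a) \<otimes>\<^bsub>P\<^esub> ?x \<oplus>\<^bsub>P\<^esub> (\<lambda>i. if i = n then y else \<zero>)"
        using \<iota>[OF step.hyps(1)]
        by (auto simp: petit_scalar_mult[OF \<iota>[OF step.hyps(1)] x] P_simps(5) skew_add_def)
      then show ?case using scalar_ext.step[OF step.hyps(1) x step.IH] by simp
    qed
    have "(\<lambda>i. if i < n then p i else \<zero>) \<in> ?JP" if "n \<le> m" for n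
      using that
    proof (induction n)
      case 0
      then show ?case using scalar_ext.zero[of P] by (simp add: P_simps(4))
    next
      case (Suc n)
      have "(\<lambda>i. if i < n then p i else \<zero>) \<oplus>\<^bsub>P\<^esub> (\<lambda>i. if i = n then p n else \<zero>) \<in> ?JP"
        using Suc p by (intro P.scalar_ext_add mono cst) auto
      moreover have "(\<lambda>i. if i < n then p i else \<zero>) \<oplus>\<^bsub>P\<^esub> (\<lambda>i. if i = n then p n else \<zero>) =
          (\<lambda>i. if i < Suc n then p i else \<zero>)"
        using p(1) by (auto simp: P_simps(5) skew_add_def less_Suc_eq carrier_P_iff)
      ultimately show ?case by simp
    qed
    moreover have "(\<lambda>i. if i < m then p i else \<zero>) = p" using p(1) by (auto simp: carrier_P_iff)
    ultimately show ?thesis by (metis order_refl)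
  qed
  moreover have "?JP \<subseteq> carrier P" by (rule P.scalar_ext_subset) (rule cst)
  ultimately show ?thesis by blast
qed

text \<open>The first isomorphism theorem without associativity. \<open>J\<close> is given merely as
  a set of elements; its structure and the well-definedness of coset multiplication are read off
  from the fibres of \<open>H\<close>.\<close>

lemma quot_isomI:
  assumes A: "nonassoc_ring A" and JA: "J \<subseteq> carrier A"
    and H: "H \<in> ring_hom A B" and surj: "H ` carrier A = carrier B"
    and ker: "\<And>x y. x \<in> carrier A \<Longrightarrow> y \<in> carrier A \<Longrightarrow> H x = H y \<longleftrightarrow> x \<ominus>\<^bsub>A\<^esub> y \<in> J"
  shows "ring_isom (A Quot J) B"
proof -
  interpret A: nonassoc_ring A by fact
  have "\<ominus>\<^bsub>A\<^esub> \<zero>\<^bsub>A\<^esub> = \<zero>\<^bsub>A\<^esub>" by (rule A.minus_equality) auto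
  then have "x \<ominus>\<^bsub>A\<^esub> \<zero>\<^bsub>A\<^esub> = x" if "x \<in> carrier A" for x
    unfolding A.minus_eq using that by (metis A.r_zero)
  \<comment> \<open>Comparing with zero in the kernel hypothesis shows that \<open>J\<close> is the
    fibre of \<open>H\<close> through zero; the subgroup laws follow from the additivity of
    \<open>H\<close>.\<close>
  then have J_iff: "x \<in> J \<longleftrightarrow> x \<in> carrier A \<and> H x = H \<zero>\<^bsub>A\<^esub>" for x
    using ker[of x "\<zero>\<^bsub>A\<^esub>"] JA by (metis A.zero_closed subsetD)
  have "subgroup J (add_monoid A)"
  proof (rule A.add.subgroupI)
    show "J \<subseteq> carrier A" by (rule JA)
    show "J \<noteq> {}" using J_iff[of "\<zero>\<^bsub>A\<^esub>"] by auto
    show "\<ominus>\<^bsub>A\<^esub> x \<in> J" if "x \<in> J" for x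
      using ker[of "\<zero>\<^bsub>A\<^esub>" x] that by (auto simp: J_iff A.minus_eq)
    show "x \<oplus>\<^bsub>A\<^esub> y \<in> J" if "x \<in> J" "y \<in> J" for x y
      using that ring_hom_add[OF H, of x y] ring_hom_add[OF H, of "\<zero>\<^bsub>A\<^esub>" "\<zero>\<^bsub>A\<^esub>"] by (auto simp: J_iff)
  qed
  then have J: "additive_subgroup J A" by (rule additive_subgroup.intro)
  interpret J: additive_subgroup J A by (rule J)
  interpret J: abelian_subgroup J A by (rule abelian_subgroupI3[OF J A.abelian_group_axioms])
  have mem: "y \<in> J +>\<^bsub>A\<^esub> x \<longleftrightarrow> y \<in> carrier A \<and> H y = H x" if x: "x \<in> carrier A" for x y
  proof
    assume "y \<in> J +>\<^bsub>A\<^esub> x"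
    then obtain j where j: "j \<in> J" "y = j \<oplus>\<^bsub>A\<^esub> x" by (auto simp: a_r_coset_def')
    then have c: "j \<in> carrier A" "y \<in> carrier A" using x J.a_Hcarr by auto
    have "y \<ominus>\<^bsub>A\<^esub> x = j" using c x j by (simp add: A.minus_eq A.a_assoc A.r_neg)
    then show "y \<in> carrier A \<and> H y = H x" using ker c x j by auto
  next
    assume y: "y \<in> carrier A \<and> H y = H x"
    then have "y \<ominus>\<^bsub>A\<^esub> x \<in> J" "y = (y \<ominus>\<^bsub>A\<^esub> x) \<oplus>\<^bsub>A\<^esub> x"
      using ker x by (auto simp: A.minus_eq A.a_assoc A.l_neg)
    then show "y \<in> J +>\<^bsub>A\<^esub> x" by (auto simp: a_r_coset_def')
  qed
  have coset_eq: "J +>\<^bsub>A\<^esub> x = J +>\<^bsub>A\<^esub> y \<longleftrightarrow> H x = H y" if "x \<in> carrier A" "y \<in> carrier A" for x y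
  proof
    assume "J +>\<^bsub>A\<^esub> x = J +>\<^bsub>A\<^esub> y"
    then have "x \<in> J +>\<^bsub>A\<^esub> y" using mem[OF that(1), of x] that by simp
    then show "H x = H y" using mem[OF that(2)] by simp
  next
    assume "H x = H y"
    then have "z \<in> J +>\<^bsub>A\<^esub> x \<longleftrightarrow> z \<in> J +>\<^bsub>A\<^esub> y" for z by (simp add: mem that)
    then show "J +>\<^bsub>A\<^esub> x = J +>\<^bsub>A\<^esub> y" by (rule Set.set_eqI)
  qed
  have carr: "carrier (A Quot J) = (\<lambda>x. J +>\<^bsub>A\<^esub> x) ` carrier A"
    by (auto simp: FactRing_def A_RCOSETS_def')
  define h where "h = (\<lambda>X. the_elem (H ` X))"
  have h: "h (J +>\<^bsub>A\<^esub> x) = H x" if x: "x \<in> carrier A" for x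
  proof -
    have "H ` (J +>\<^bsub>A\<^esub> x) = {H x}" using x by (auto simp: mem)
    then show ?thesis by (simp add: h_def)
  qed
  have add: "(J +>\<^bsub>A\<^esub> x) \<oplus>\<^bsub>A Quot J\<^esub> (J +>\<^bsub>A\<^esub> y) = J +>\<^bsub>A\<^esub> (x \<oplus>\<^bsub>A\<^esub> y)"
    if "x \<in> carrier A" "y \<in> carrier A" for x y
    using J.a_rcos_sum[OF that] by (simp add: FactRing_def)
  have mult: "(J +>\<^bsub>A\<^esub> x) \<otimes>\<^bsub>A Quot J\<^esub> (J +>\<^bsub>A\<^esub> y) = J +>\<^bsub>A\<^esub> (x \<otimes>\<^bsub>A\<^esub> y)"
    if xy: "x \<in> carrier A" "y \<in> carrier A" for x y
  proof -
    \<comment> \<open>The product of cosets in \<open>FactRing\<close> is a union over all pairs of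
      representatives. Multiplicativity of \<open>H\<close> makes all members of this union the same
      coset.\<close>
    have "J +>\<^bsub>A\<^esub> (a \<otimes>\<^bsub>A\<^esub> b) = J +>\<^bsub>A\<^esub> (x \<otimes>\<^bsub>A\<^esub> y)" if "a \<in> J +>\<^bsub>A\<^esub> x" "b \<in> J +>\<^bsub>A\<^esub> y" for a b
      using that xy by (simp add: mem coset_eq ring_hom_mult[OF H])
    moreover have "x \<in> J +>\<^bsub>A\<^esub> x" "y \<in> J +>\<^bsub>A\<^esub> y" using xy by (simp_all add: mem)
    ultimately have "(\<Union>a\<in>J +>\<^bsub>A\<^esub> x. \<Union>b\<in>J +>\<^bsub>A\<^esub> y. J +>\<^bsub>A\<^esub> (a \<otimes>\<^bsub>A\<^esub> b)) = J +>\<^bsub>A\<^esub> (x \<otimes>\<^bsub>A\<^esub> y)"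
      by blast
    then show ?thesis by (simp add: FactRing_def rcoset_mult_def)
  qed
  have "inj_on h (carrier (A Quot J))"
    unfolding carr by (rule inj_onI) (auto simp: h mem)
  moreover have "h ` carrier (A Quot J) = carrier B"
    unfolding carr image_image surj[symmetric] by (rule image_cong) (auto simp: h)
  moreover have "h \<one>\<^bsub>A Quot J\<^esub> = \<one>\<^bsub>B\<^esub>"
    using h[OF A.one_closed] ring_hom_one[OF H] by (simp add: FactRing_def)
  moreover have "h (X \<oplus>\<^bsub>A Quot J\<^esub> Y) = h X \<oplus>\<^bsub>B\<^esub> h Y \<and> h (X \<otimes>\<^bsub>A Quot J\<^esub> Y) = h X \<otimes>\<^bsub>B\<^esub> h Y"
    if "X \<in> carrier (A Quot J)" "Y \<in> carrier (A Quot J)" for X Y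
    using that unfolding carr
    by (auto simp: add mult h ring_hom_add[OF H] ring_hom_mult[OF H])
  ultimately show ?thesis unfolding ring_isom_def bij_betw_def by blast
qed

section \<open>Comaximal ideals and the Chinese remainder theorem\<close>

lemma (in cring) scalar_ext_ideal:
  assumes S: "S \<subseteq> carrier R"
  shows "ideal (scalar_ext R (\<lambda>a. a) S) R"
proof -
  interpret N: nonassoc_ring R by (rule is_nonassoc_ring)
  let ?E = "scalar_ext R (\<lambda>a. a) S"
  have sub: "?E \<subseteq> carrier R" by (rule N.scalar_ext_subset) (use S in blast)
  have zero: "\<zero> \<in> ?E" by (rule scalar_ext.zero)
  have add: "x \<oplus> y \<in> ?E" if "x \<in> ?E" "y \<in> ?E" for x y
    by (rule N.scalar_ext_add[OF _ that]) (use S in blast)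
  have mult: "x \<otimes> r \<in> ?E" if "x \<in> ?E" and r: "r \<in> carrier R" for x r
    using that(1)
  proof induction
    case zero
    then show ?case using r scalar_ext.zero[of R] by simp
  next
    case (step a x y)
    have aR: "a \<in> carrier R" and yR: "y \<in> carrier R" using step sub S by blast+
    then have "(a \<otimes> x \<oplus> y) \<otimes> r = a \<otimes> (x \<otimes> r) \<oplus> y \<otimes> r"
      using step.hyps(2) r by (simp add: l_distr m_assoc)
    then show ?case using scalar_ext.step[OF step.hyps(1) _ step.IH] step.hyps(2) r by simp
  qed
  have neg: "\<ominus> x \<in> ?E" if "x \<in> ?E" for x
  proof -
    have "\<ominus> x = x \<otimes> (\<ominus> \<one>)" using that sub by (simp add: r_minus subsetD)
    then show ?thesis using mult[OF that] by simp
  qed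
  show ?thesis
  proof (rule idealI[OF ring_axioms])
    show "subgroup ?E (add_monoid R)"
      by (rule add.subgroupI) (use sub neg add zero in \<open>auto simp flip: a_inv_def\<close>)
    fix a x assume "a \<in> ?E" "x \<in> carrier R"
    then show "a \<otimes> x \<in> ?E" "x \<otimes> a \<in> ?E"
      using mult sub m_comm by (auto simp: subset_iff)
  qed
qed

text \<open>Needed because the residue algebras are formed modulo generated ideals, while I\<Lambda>
  is given by \<open>scalar_ext\<close>; the Chinese remainder theorem has to speak of both.\<close>

lemma (in cring) genideal_eq_scalar_ext:
  assumes S: "S \<subseteq> carrier R"
  shows "Idl S = scalar_ext R (\<lambda>a. a) S"
proof (rule equalityI)
  let ?E = "scalar_ext R (\<lambda>a. a) S"
  have "s \<in> ?E" if "s \<in> S" for s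
    using scalar_ext.step[OF that one_closed scalar_ext.zero, of "\<lambda>a. a"] that S by (simp add: subsetD)
  then show "Idl S \<subseteq> ?E" by (intro genideal_minimal scalar_ext_ideal[OF S] subsetI)
next
  interpret I: ideal "Idl S" R by (rule genideal_ideal[OF S])
  show "scalar_ext R (\<lambda>a. a) S \<subseteq> Idl S"
  proof
    fix x assume "x \<in> scalar_ext R (\<lambda>a. a) S"
    then show "x \<in> Idl S"
    proof induction
      case (step a x y)
      then show ?case using genideal_self[OF S] by (intro I.a_closed I.I_r_closed) auto
    qed (rule I.zero_closed)
  qed
qed

section \<open>Subrings of the complex numbers and their comaximal ideals\<close>

lemma ring_of_set_simps [simp]:
  "carrier (ring_of_set S) = S" "x \<otimes>\<^bsub>ring_of_set S\<^esub> y = x * y" "\<one>\<^bsub>ring_of_set S\<^esub> = 1"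
  "\<zero>\<^bsub>ring_of_set S\<^esub> = 0" "x \<oplus>\<^bsub>ring_of_set S\<^esub> y = x + y"
  by (simp_all add: ring_of_set_def)

lemma ring_of_set_cring:
  assumes "0 \<in> S" "1 \<in> S" "\<And>x y. x \<in> S \<Longrightarrow> y \<in> S \<Longrightarrow> x + y \<in> S"
    "\<And>x. x \<in> S \<Longrightarrow> - x \<in> S" "\<And>x y. x \<in> S \<Longrightarrow> y \<in> S \<Longrightarrow> x * y \<in> S"
  shows "cring (ring_of_set S)"
proof (rule cringI)
  show "abelian_group (ring_of_set S)"
  proof (rule abelian_groupI)
    fix x assume "x \<in> carrier (ring_of_set S)"
    then show "\<exists>y\<in>carrier (ring_of_set S). y \<oplus>\<^bsub>ring_of_set S\<^esub> x = \<zero>\<^bsub>ring_of_set S\<^esub>"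
      using assms(4) by (intro bexI[of _ "- x"]) auto
  qed (use assms in \<open>auto simp: algebra_simps\<close>)
  show "comm_monoid (ring_of_set S)"
    by (rule comm_monoidI) (use assms in \<open>auto simp: algebra_simps\<close>)
qed (auto simp: algebra_simps)

lemma ring_of_set_minus:
  assumes "cring (ring_of_set S)" "x \<in> S"
  shows "\<ominus>\<^bsub>ring_of_set S\<^esub> x = - x"
proof -
  interpret cring "ring_of_set S" by fact
  have "\<ominus>\<^bsub>ring_of_set S\<^esub> x + x = 0" using l_neg[of x] assms(2) by simp
  then show ?thesis by (simp add: eq_neg_iff_add_eq_0)
qed

lemma subfield_cring:
  assumes "is_subfield_C K"
  shows "cring (ring_of_set K)"
proof (rule ring_of_set_cring)
  have K: "x + y \<in> K" "x - y \<in> K" "x * y \<in> K" if "x \<in> K" "y \<in> K" for x y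
    using assms that unfolding is_subfield_C_def by blast+
  show "0 \<in> K" "1 \<in> K" using assms unfolding is_subfield_C_def by blast+
  then show "- x \<in> K" if "x \<in> K" for x using K(2)[OF \<open>0 \<in> K\<close> that] by simp
  show "x + y \<in> K" "x * y \<in> K" if "x \<in> K" "y \<in> K" for x y using K that by blast+
qed

lemma ring_of_integers_cring:
  assumes "is_subfield_C K"
  shows "cring (OKr K)"
proof -
  interpret K: cring "ring_of_set K" by (rule subfield_cring[OF assms])
  show ?thesis
    using K.zero_closed K.one_closed K.a_closed K.m_closed K.a_inv_closed
    by (intro ring_of_set_cring)
       (auto simp: ring_of_integers_def algebraic_int_add algebraic_int_mult ring_of_set_minus[OF K.cring_axioms])
qed

definition comaximal :: "complex set \<Rightarrow> complex set \<Rightarrow> bool" where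
  "comaximal I J \<longleftrightarrow> (\<exists>a\<in>I. \<exists>b\<in>J. a + b = 1)"

lemma comaximal_sym: "comaximal I J \<Longrightarrow> comaximal J I"
  unfolding comaximal_def by (metis add.commute)

lemma ideal_ring_of_setD:
  assumes "ideal I (ring_of_set A)"
  shows "I \<subseteq> A" "0 \<in> I" "x \<in> I \<Longrightarrow> y \<in> I \<Longrightarrow> x + y \<in> I" "x \<in> I \<Longrightarrow> a \<in> A \<Longrightarrow> a * x \<in> I"
    "x \<in> I \<Longrightarrow> a \<in> A \<Longrightarrow> x * a \<in> I"
  using ideal.Icarr[OF assms] additive_subgroup.zero_closed[OF ideal.axioms(1)[OF assms]]
    additive_subgroup.a_closed[OF ideal.axioms(1)[OF assms]] ideal.I_l_closed[OF assms]
    ideal.I_r_closed[OF assms]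
  by auto

text \<open>Expanding (a + b) (a' + b') = 1 leaves b b' as the only term without a factor from
  \<open>Q\<close>.\<close>

lemma comaximal_ideal_prod:
  assumes Q: "ideal Q (ring_of_set A)" and I: "ideal I (ring_of_set A)" and J: "ideal J (ring_of_set A)"
    and "comaximal Q I" "comaximal Q J"
  shows "comaximal Q (ideal_prod (ring_of_set A) I J)"
proof -
  obtain a b a' b' where ab: "a \<in> Q" "b \<in> I" "a + b = 1" "a' \<in> Q" "b' \<in> J" "a' + b' = 1"
    using assms(4,5) unfolding comaximal_def by blast
  note Q' = ideal_ring_of_setD[OF Q] and I' = ideal_ring_of_setD[OF I] and J' = ideal_ring_of_setD[OF J]
  have "a * a' + a * b' + b * a' \<in> Q"
    using ab Q' I' J' by (meson subsetD)
  moreover have "b * b' \<in> ideal_prod (ring_of_set A) I J"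
    using ideal_prod.prod[OF ab(2,5), of "ring_of_set A"] by simp
  moreover have "(a * a' + a * b' + b * a') + b * b' = (a + b) * (a' + b')" by (simp add: algebra_simps)
  ultimately show ?thesis unfolding comaximal_def using ab by (metis mult_1)
qed

lemma comaximal_ring:
  assumes "cring (ring_of_set A)" "ideal Q (ring_of_set A)"
  shows "comaximal Q A"
proof -
  interpret cring "ring_of_set A" by fact
  show ?thesis unfolding comaximal_def
    using ideal_ring_of_setD(2)[OF assms(2)] one_closed by (intro bexI[of _ 0] bexI[of _ 1]) auto
qed

lemma ideal_pow_ideal:
  assumes "ring R" "ideal q R"
  shows "ideal (ideal_pow R q s) R"
  by (induction s) (use assms in \<open>auto intro: ring.oneideal ring.ideal_prod_is_ideal\<close>)

lemma comaximal_ideal_pow: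
  assumes A: "cring (ring_of_set A)" and Q: "ideal Q (ring_of_set A)" and q: "ideal q (ring_of_set A)"
    and "comaximal Q q"
  shows "comaximal Q (ideal_pow (ring_of_set A) q s)"
proof (induction s)
  case 0
  then show ?case using comaximal_ring[OF A Q] by simp
next
  case (Suc s)
  then show ?case
    using comaximal_ideal_prod[OF Q ideal_pow_ideal[OF cring.axioms(1)[OF A] q] q] assms(4) by simp
qed

lemma scalar_ext_mono: "I \<subseteq> J \<Longrightarrow> scalar_ext R \<iota> I \<subseteq> scalar_ext R \<iota> J"
proof
  fix x assume "I \<subseteq> J" "x \<in> scalar_ext R \<iota> I"
  from this(2) show "x \<in> scalar_ext R \<iota> J"
    by induction (use \<open>I \<subseteq> J\<close> in \<open>auto intro: scalar_ext.intros\<close>)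
qed

text \<open>Multiplying by a comaximality witness adds the missing ideal factor. For a + b = 1 this
  is applied to each summand of y = a y + b y.\<close>

lemma scalar_ext_mult_prod:
  assumes B: "cring (ring_of_set B)" and sub: "I \<subseteq> B" "J \<subseteq> B" and a: "a \<in> I"
    and y: "y \<in> scalar_ext (ring_of_set B) (\<lambda>a. a) J"
  shows "a * y \<in> scalar_ext (ring_of_set B) (\<lambda>a. a) (ideal_prod (ring_of_set A) I J)"
  using y
proof induction
  case zero
  then show ?case using scalar_ext.zero[of "ring_of_set B"] by simp
next
  case (step b x y)
  have "a * b \<in> ideal_prod (ring_of_set A) I J"
    using ideal_prod.prod[OF a step.hyps(1), of "ring_of_set A"] by simp
  from scalar_ext.step[OF this step.hyps(2) step.IH] show ?case by (simp add: algebra_simps)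
qed

lemma (in ring) ideal_prod_list_ideal:
  "\<forall>J\<in>set Is. ideal J R \<Longrightarrow> ideal (ideal_prod_list R Is) R"
  by (induction Is) (auto simp: ideal_prod_list_def oneideal ideal_prod_is_ideal)

lemma (in ring) ideal_prod_list_subset:
  assumes "\<forall>J\<in>set Is. ideal J R" "J \<in> set Is"
  shows "ideal_prod_list R Is \<subseteq> J"
  using assms
proof (induction Is)
  case (Cons J' Is)
  have "ideal_prod_list R (J' # Is) = J' \<cdot> ideal_prod_list R Is" by (simp add: ideal_prod_list_def)
  then have "ideal_prod_list R (J' # Is) \<subseteq> J' \<inter> ideal_prod_list R Is"
    using Cons.prems ideal_prod_list_ideal[of Is] ideal_prod_inter by simp
  then show ?case using Cons by auto
qed simp

text \<open>The witnesses of comaximality lie in \<open>A\<close> and stay valid in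
  \<open>B\<close>, so the theorem for the extended ideals of \<open>B\<close> uses products of
  ideals of \<open>A\<close> only. The first claim is joint surjectivity, the second identifies the
  common kernel with the extension of the product.\<close>

lemma chinese_remainder_extension:
  fixes A B :: "complex set" and P :: "'i \<Rightarrow> complex set"
  assumes A: "cring (ring_of_set A)" and B: "cring (ring_of_set B)" and AB: "A \<subseteq> B"
    and "distinct js"
    and P: "\<And>j. j \<in> set js \<Longrightarrow> ideal (P j) (ring_of_set A)"
    and co: "\<And>i j. i \<in> set js \<Longrightarrow> j \<in> set js \<Longrightarrow> i \<noteq> j \<Longrightarrow> comaximal (P i) (P j)"
  defines "ext \<equiv> scalar_ext (ring_of_set B) (\<lambda>a. a)"
  defines "M \<equiv> \<lambda>js. ideal_prod_list (ring_of_set A) (map P js)"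
  shows "(\<forall>j\<in>set js. x j \<in> B) \<Longrightarrow> \<exists>z\<in>B. \<forall>j\<in>set js. z - x j \<in> ext (P j)"
    and "{y \<in> B. \<forall>j\<in>set js. y \<in> ext (P j)} = ext (M js)"
proof -
  interpret A: cring "ring_of_set A" by fact
  interpret B: cring "ring_of_set B" by fact
  have extI: "ideal (ext I) (ring_of_set B)" if "ideal I (ring_of_set A)" for I
    unfolding ext_def by (rule B.scalar_ext_ideal) (use ideal_ring_of_setD(1)[OF that] AB in simp)
  have ext_mem: "a * y \<in> ext I" if "ideal I (ring_of_set A)" "a \<in> I" "y \<in> B" for a y I
    using scalar_ext.step[OF that(2) _ scalar_ext.zero, of y "ring_of_set B" "\<lambda>a. a"] that by (simp add: ext_def)
  have M_Cons: "M (j # js) = ideal_prod (ring_of_set A) (P j) (M js)" for j js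
    by (simp add: M_def ideal_prod_list_def)
  have M_Nil: "M [] = A" by (simp add: M_def ideal_prod_list_def)
  have ideal_M: "ideal (M js) (ring_of_set A)" if "\<forall>j\<in>set js. ideal (P j) (ring_of_set A)" for js
    unfolding M_def by (rule A.ideal_prod_list_ideal) (use that in simp)
  have M_le: "M js \<subseteq> P j" if "\<forall>j\<in>set js. ideal (P j) (ring_of_set A)" "j \<in> set js" for js j
    unfolding M_def by (rule A.ideal_prod_list_subset) (use that in auto)
  have co_M: "comaximal Q (M js)"
    if Q: "ideal Q (ring_of_set A)" and "\<forall>j\<in>set js. ideal (P j) (ring_of_set A) \<and> comaximal Q (P j)" for Q js
    using that(2)
  proof (induction js)
    case Nil
    then show ?case using comaximal_ring[OF A Q] by (simp add: M_Nil)
  next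
    case (Cons j js)
    then show ?case unfolding M_Cons by (intro comaximal_ideal_prod Q ideal_M) auto
  qed
  have "(\<forall>x. (\<forall>j\<in>set js. x j \<in> B) \<longrightarrow> (\<exists>z\<in>B. \<forall>j\<in>set js. z - x j \<in> ext (P j))) \<and>
      {y \<in> B. \<forall>j\<in>set js. y \<in> ext (P j)} = ext (M js)"
    using \<open>distinct js\<close> P co
  proof (induction js)
    case Nil
    \<comment> \<open>The empty product is \<open>A\<close>, which contains 1, so its extension is
      all of \<open>B\<close>, matching the empty intersection.\<close>
    have "y \<in> ext A" if "y \<in> B" for y
      using ext_mem[OF A.oneideal[simplified], of 1 y] that A.one_closed by simp
    moreover have "ext A \<subseteq> B" using ideal_ring_of_setD(1)[OF extI[OF A.oneideal]] by simp
    ultimately show ?case using B.zero_closed by (auto simp: M_Nil)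
  next
    case (Cons i js)
    have Pi: "ideal (P i) (ring_of_set A)" and Pjs: "\<forall>j\<in>set js. ideal (P j) (ring_of_set A)"
      using Cons.prems(2) by auto
    have IH: "\<And>x. (\<forall>j\<in>set js. x j \<in> B) \<Longrightarrow> \<exists>z\<in>B. \<forall>j\<in>set js. z - x j \<in> ext (P j)"
        "{y \<in> B. \<forall>j\<in>set js. y \<in> ext (P j)} = ext (M js)"
      using Cons by auto
    note Mi = ideal_M[OF Pjs]
    have "comaximal (P i) (M js)"
      by (rule co_M[OF Pi]) (use Cons.prems in auto)
    then obtain a b where ab: "a \<in> P i" "b \<in> M js" "a + b = 1" unfolding comaximal_def by blast
    have aB: "a \<in> B" and bB: "b \<in> B"
      using ab ideal_ring_of_setD(1)[OF Pi] ideal_ring_of_setD(1)[OF Mi] AB by blast+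
    have b_eq: "b = 1 - a" and a_eq: "a = 1 - b" using ab(3) by (simp_all add: algebra_simps)
    have Bclosed: "x + y \<in> B" "x - y \<in> B" "x * y \<in> B" if "x \<in> B" "y \<in> B" for x y
      using B.a_closed[of x y] B.m_closed[of x y] B.minus_closed[of x y] that
        ring_of_set_minus[OF B that(2)] by (auto simp: a_minus_def)
    have sub: "M (i # js) \<subseteq> P j" if "j \<in> set (i # js)" for j
      by (rule M_le) (use Cons.prems that in auto)
    have crt: "\<exists>z\<in>B. \<forall>j\<in>set (i # js). z - x j \<in> ext (P j)" if x: "\<forall>j\<in>set (i # js). x j \<in> B" for x
    proof -
      obtain z where z: "z \<in> B" "\<And>j. j \<in> set js \<Longrightarrow> z - x j \<in> ext (P j)"
        using IH(1)[of x] x by auto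
      \<comment> \<open>Modulo \<open>P i\<close> the element b = 1 - a is 1, and modulo every
        \<open>P j\<close> of the tail it is 0, because \<open>M js\<close> is contained in each of
        them. Hence a z + b x_i takes the value x_i at \<open>i\<close> and keeps those of
        \<open>z\<close> elsewhere.\<close>
      have "(a * z + b * x i) - x i = a * (z - x i)" by (simp add: b_eq algebra_simps)
      also have "\<dots> \<in> ext (P i)" using x z by (intro ext_mem[OF Pi ab(1)] Bclosed) auto
      finally have 1: "(a * z + b * x i) - x i \<in> ext (P i)" .
      have 2: "(a * z + b * x i) - x j \<in> ext (P j)" if j: "j \<in> set js" for j
      proof -
        have Pj: "ideal (P j) (ring_of_set A)" using Pjs j by blast
        have "b * (x i - z) \<in> ext (P j)"
          using subsetD[OF M_le[OF Pjs j] ab(2)] x z by (intro ext_mem[OF Pj] Bclosed) auto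
        then have "(z - x j) + b * (x i - z) \<in> ext (P j)"
          by (rule ideal_ring_of_setD(3)[OF extI[OF Pj] z(2)[OF j]])
        then show ?thesis by (simp add: a_eq algebra_simps)
      qed
      show ?thesis using 1 2 x z aB bB by (intro bexI[of _ "a * z + b * x i"] Bclosed) auto
    qed
    \<comment> \<open>In y = a y + b y the first summand combines \<open>a\<close> from
      \<open>P i\<close> with \<open>y\<close> from the extension of \<open>M js\<close>, the second
      the other way round; both lie in the extension of the product.\<close>
    have "y \<in> ext (M (i # js))" if y: "y \<in> ext (P i)" "y \<in> ext (M js)" for y
    proof -
      have MB: "M js \<subseteq> B" and PB: "P i \<subseteq> B" using ideal_ring_of_setD(1) Mi Pi AB by blast+
      have "a * y \<in> ext (M (i # js))"
        using scalar_ext_mult_prod[OF B PB MB ab(1), of y A] y(2) by (simp add: ext_def M_Cons)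
      moreover have "b * y \<in> ext (M (i # js))"
        using scalar_ext_mult_prod[OF B MB PB ab(2), of y A] y(1)
        by (simp add: ext_def M_Cons A.ideal_prod_commute[OF Pi Mi])
      moreover have "ideal (M (i # js)) (ring_of_set A)" using ideal_M[of "i # js"] Pi Pjs by simp
      ultimately have "a * y + b * y \<in> ext (M (i # js))" using ideal_ring_of_setD(3)[OF extI] by blast
      then show ?thesis by (simp add: b_eq algebra_simps)
    qed
    then have "ext (P i) \<inter> ext (M js) \<subseteq> ext (M (i # js))" by blast
    moreover have ext_le: "ext (M (i # js)) \<subseteq> ext (P j)" if "j \<in> set (i # js)" for j
      unfolding ext_def by (rule scalar_ext_mono[OF sub[OF that]])
    have "ext (M (i # js)) \<subseteq> ext (P i) \<inter> {y \<in> B. \<forall>j\<in>set js. y \<in> ext (P j)}"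
      using ext_le[of i] ideal_ring_of_setD(1)[OF extI[OF Pi]] ext_le[OF list.set_intros(2)] by auto
    ultimately have "ext (P i) \<inter> {y \<in> B. \<forall>j\<in>set js. y \<in> ext (P j)} = ext (M (i # js))"
      unfolding IH(2) by (rule equalityI)
    then have "{y \<in> B. \<forall>j\<in>set (i # js). y \<in> ext (P j)} = ext (M (i # js))" by auto
    with crt show ?case by blast
  qed
  then show "(\<forall>j\<in>set js. x j \<in> B) \<Longrightarrow> \<exists>z\<in>B. \<forall>j\<in>set js. z - x j \<in> ext (P j)"
    and "{y \<in> B. \<forall>j\<in>set js. y \<in> ext (P j)} = ext (M js)" by blast+
qed

section \<open>Maximality of non-zero primes\<close>

lemma of_int_mem_ring:
  assumes "cring (ring_of_set A)"
  shows "of_int k \<in> A"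
proof -
  interpret cring "ring_of_set A" by fact
  have nat: "of_nat n \<in> A" for n
    by (induction n) (use zero_closed one_closed a_closed in auto)
  have "- of_nat n \<in> A" for n
    using a_inv_closed[of "of_nat n"] nat ring_of_set_minus[OF assms nat] by simp
  with nat show ?thesis by (cases k) (auto simp del: of_nat_Suc)
qed

lemma ipoly_mem_ring:
  assumes A: "cring (ring_of_set A)" and "x \<in> A"
  shows "poly (map_poly of_int p) x \<in> A"
proof (induction p)
  case 0
  then show ?case using of_int_mem_ring[OF A, of 0] by simp
next
  case (pCons a p)
  interpret cring "ring_of_set A" by fact
  have "x * poly (map_poly of_int p) x \<in> A" using m_closed assms(2) pCons.IH by simp
  then show ?case
    using a_closed[of "of_int a"] of_int_mem_ring[OF A] by (simp add: of_int_hom.map_poly_pCons_hom)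
qed

text \<open>Take a monic integer polynomial p = k + X p' of least degree whose value at
  \<open>x\<close> lies in \<open>q\<close>. If \<open>k\<close> were in \<open>q\<close>, then x
  p'(x) would be too, and primality would pass to the monic p' of smaller degree. So modulo
  \<open>q\<close> the element \<open>x\<close> divides a non-zero integer. \<open>q\<close> is
  given by the laws used rather than as an ideal, and {0} is one of its two instances.\<close>

lemma integer_outside_prime:
  assumes A: "cring (ring_of_set A)" and x: "x \<in> A" "algebraic_int x" "x \<notin> q"
    and q1: "1 \<notin> q"
    and prime: "\<And>u v. u \<in> A \<Longrightarrow> v \<in> A \<Longrightarrow> u * v \<in> q \<Longrightarrow> u \<in> q \<or> v \<in> q"
    and zero: "0 \<in> q" and add: "\<And>u v. u \<in> q \<Longrightarrow> v \<in> q \<Longrightarrow> u - v \<in> q"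
  obtains k w where "of_int k \<notin> q" "w \<in> A" "of_int k + x * w \<in> q"
proof -
  let ?ev = "\<lambda>p. poly (map_poly of_int p) x"
  let ?Q = "\<lambda>n. \<exists>p :: int poly. lead_coeff p = 1 \<and> degree p = n \<and> ?ev p \<in> q"
  have "\<exists>n. ?Q n" using x(2) zero unfolding algebraic_int_altdef_ipoly by metis
  then have "?Q (LEAST n. ?Q n)" by (rule LeastI_ex)
  then obtain p where p: "lead_coeff p = 1" "degree p = (LEAST n. ?Q n)" "?ev p \<in> q" by blast
  obtain k p' where pc: "p = pCons k p'" by (cases p)
  have ev: "?ev p = of_int k + x * ?ev p'" by (simp add: pc of_int_hom.map_poly_pCons_hom)
  have "p' \<noteq> 0"
  proof
    assume "p' = 0"
    then have "?ev p = 1" using p(1) ev by (simp add: pc)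
    then show False using p(3) q1 by simp
  qed
  then have deg: "lead_coeff p' = 1" "degree p' < degree p" using p(1) by (auto simp: pc)
  have w: "?ev p' \<in> A" by (rule ipoly_mem_ring[OF A x(1)])
  have "of_int k \<notin> q"
  proof
    assume "of_int k \<in> q"
    then have "?ev p - of_int k \<in> q" by (rule add[OF p(3)])
    then have "x * ?ev p' \<in> q" unfolding ev by simp
    then have "?ev p' \<in> q" using prime[OF x(1) w] x(3) by blast
    then have "?Q (degree p')" using deg(1) by blast
    then have "(LEAST n. ?Q n) \<le> degree p'" by (rule Least_le)
    then show False using p(2) deg(2) by simp
  qed
  then show thesis using that w p(3) ev by metis
qed

lemma ideal_ring_of_set_diff:
  assumes A: "cring (ring_of_set A)" and J: "ideal J (ring_of_set A)" and "u \<in> J" "v \<in> J"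
  shows "u - v \<in> J"
proof -
  have "(-1) * v \<in> J"
    using ideal_ring_of_setD(4)[OF J assms(4), of "-1"] of_int_mem_ring[OF A, of "-1"] by simp
  then show ?thesis using ideal_ring_of_setD(3)[OF J assms(3)] by fastforce
qed

text \<open>Everything is compared through integers: \<open>q\<close> contains a positive one, and a
  strictly larger ideal contains one outside \<open>q\<close>; modulo the least positive integer of
  \<open>q\<close> the latter is invertible.\<close>

lemma nonzero_primeideal_maximal:
  assumes A: "cring (ring_of_set A)" and int: "\<And>x. x \<in> A \<Longrightarrow> algebraic_int x"
    and q: "primeideal q (ring_of_set A)" and "q \<noteq> {0}"
    and J: "ideal J (ring_of_set A)" "q \<subseteq> J" "q \<noteq> J"
  shows "1 \<in> J"
proof -
  interpret A: cring "ring_of_set A" by fact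
  interpret q: primeideal q "ring_of_set A" by fact
  note qD = ideal_ring_of_setD[OF q.is_ideal] and JD = ideal_ring_of_setD[OF J(1)]
  note of_int = of_int_mem_ring[OF A]
  have prime: "u \<in> q \<or> v \<in> q" if "u \<in> A" "v \<in> A" "u * v \<in> q" for u v
    using q.I_prime[of u v] that by simp
  have q1: "1 \<notin> q"
  proof
    assume "1 \<in> q"
    then have "A \<subseteq> q" using qD(4)[of 1] by auto
    then show False using q.I_notcarr qD(1) by auto
  qed
  obtain y where y: "y \<in> q" "y \<noteq> 0" using \<open>q \<noteq> {0}\<close> qD(2) by blast
  then have yA: "y \<in> A" using qD(1) by blast
  \<comment> \<open>With {0} as the prime: the non-zero \<open>y\<close> divides a non-zero integer
    in \<open>A\<close>, and this integer therefore lies in \<open>q\<close>.\<close>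
  obtain N0 w where N0: "of_int N0 \<notin> {0 :: complex}" "w \<in> A" "of_int N0 + y * w \<in> {0}"
    by (rule integer_outside_prime[OF A yA int[OF yA], of "{0}"]) (use y in auto)
  have "0 - y * w \<in> q"
    by (intro ideal_ring_of_set_diff[OF A q.is_ideal] qD(2) qD(5)[OF y(1) N0(2)])
  moreover have "0 - y * w = of_int N0" using N0(3) by (simp only: diff_eq_eq singleton_iff)
  ultimately have N0q: "of_int N0 \<in> q" by simp
  then have "of_int (- N0) \<in> q" using ideal_ring_of_set_diff[OF A q.is_ideal qD(2) N0q] by simp
  then have "of_nat (nat \<bar>N0\<bar>) \<in> q" using N0q by (cases "N0 \<ge> 0") auto
  moreover have "nat \<bar>N0\<bar> > 0" using N0(1) by simp
  ultimately have ex: "\<exists>n. n > 0 \<and> of_nat n \<in> q" by blast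
  define p where "p = (LEAST n. n > 0 \<and> of_nat n \<in> q)"
  have p: "p > 0" "of_nat p \<in> q" using LeastI_ex[OF ex] unfolding p_def by blast+
  have p_min: "p \<le> n" if "n > 0" "of_nat n \<in> q" for n
    unfolding p_def by (rule Least_le) (use that in blast)
  obtain x where x: "x \<in> J" "x \<notin> q" using J(2,3) by blast
  then have xA: "x \<in> A" using JD(1) by blast
  \<comment> \<open>Now with \<open>q\<close> itself: \<open>x\<close> divides \<open>k\<close>
    modulo \<open>q\<close>, and as both \<open>x\<close> and \<open>q\<close> lie in
    \<open>J\<close>, so does \<open>k\<close>.\<close>
  obtain k v where k: "of_int k \<notin> q" "v \<in> A" "of_int k + x * v \<in> q"
    by (rule integer_outside_prime[OF A xA int[OF xA] x(2) q1 prime qD(2)])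
      (auto intro: ideal_ring_of_set_diff[OF A q.is_ideal])
  have "(of_int k + x * v) - x * v \<in> J"
    using k(3) J(2) JD(5)[OF x(1) k(2)] by (intro ideal_ring_of_set_diff[OF A J(1)]) auto
  then have kJ: "of_int k \<in> J" by simp
  \<comment> \<open>Bezout puts \<open>g\<close> into \<open>J\<close>. It is not in
    \<open>q\<close>, since it divides \<open>k\<close>; so the cofactor \<open>h\<close> of p = g h
    is in \<open>q\<close>, and minimality of \<open>p\<close> leaves only g = 1.\<close>
  define g where "g = gcd k (int p)"
  obtain u u' where bezout: "u * k + u' * int p = g" unfolding g_def by (metis bezout_int)
  have g_pos: "g > 0" using p(1) by (simp add: g_def)
  have "of_int u * of_int k + of_int u' * of_nat p \<in> J"
    using J(2) p(2) by (intro JD(3) JD(4) kJ of_int) auto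
  moreover have "of_int u * of_int k + of_int u' * of_nat p = (of_int g :: complex)"
    by (simp flip: bezout)
  ultimately have gJ: "of_int g \<in> J" by simp
  have "of_int g \<notin> q"
  proof
    assume "of_int g \<in> q"
    moreover obtain t where "k = g * t" unfolding g_def by (metis dvd_def gcd_dvd1)
    ultimately have "of_int k \<in> q" using qD(5)[of "of_int g" "of_int t"] of_int by simp
    then show False using k(1) by simp
  qed
  moreover obtain h where h: "int p = g * h" unfolding g_def by (metis dvd_def gcd_dvd2)
  moreover have "of_int g * of_int h \<in> q" using p(2) h by (metis of_int_mult of_int_of_nat_eq)
  ultimately have hq: "of_int h \<in> q" using prime[OF of_int of_int, of g h] by blast
  have h_pos: "h > 0" using h p(1) g_pos by (metis of_nat_0_less_iff zero_less_mult_pos)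
  have "p \<le> nat h" by (rule p_min) (use hq h_pos in auto)
  then have "int p \<le> h" using h_pos by linarith
  then have "g * h \<le> 1 * h" by (simp only: h mult_1)
  then have "g \<le> 1" using h_pos by (rule mult_right_le_imp_le)
  then have "g = 1" using g_pos by linarith
  then show "1 \<in> J" using gJ by simp
qed

lemma distinct_primes_comaximal:
  assumes A: "cring (ring_of_set A)" and int: "\<And>x. x \<in> A \<Longrightarrow> algebraic_int x"
    and p: "primeideal p (ring_of_set A)" "p \<noteq> {0}" and q: "primeideal q (ring_of_set A)" "q \<noteq> {0}"
    and "p \<noteq> q"
  shows "comaximal p q"
proof -
  interpret A: cring "ring_of_set A" by fact
  have pI: "ideal p (ring_of_set A)" and qI: "ideal q (ring_of_set A)"
    using p q by (auto dest: primeideal.axioms(1))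
  note pD = ideal_ring_of_setD[OF pI] and qD = ideal_ring_of_setD[OF qI]
  let ?J = "p <+>\<^bsub>ring_of_set A\<^esub> q"
  have J: "ideal ?J (ring_of_set A)" by (rule A.add_ideals[OF pI qI])
  have mem: "z \<in> ?J \<longleftrightarrow> (\<exists>a\<in>p. \<exists>b\<in>q. z = a + b)" for z by (simp add: set_add_def')
  have pJ: "p \<subseteq> ?J" unfolding subset_iff mem using qD(2) by (metis add_0_right)
  have qJ: "q \<subseteq> ?J" unfolding subset_iff mem using pD(2) by (metis add_0)
  have "1 \<in> ?J"
  \<comment> \<open>If \<open>q\<close> is not contained in \<open>p\<close>, the sum is strictly
    larger than \<open>p\<close>, and maximality of \<open>p\<close> applies. Otherwise
    \<open>p\<close> is strictly larger than \<open>q\<close>, and maximality of \<open>q\<close>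
    puts 1 already into \<open>p\<close>.\<close>
  proof (cases "q \<subseteq> p")
    case False
    then have "p \<noteq> ?J" using qJ by blast
    then show ?thesis using nonzero_primeideal_maximal[OF A int p J pJ] by blast
  next
    case True
    then have "1 \<in> p" using nonzero_primeideal_maximal[OF A int q pI] \<open>p \<noteq> q\<close> by blast
    then show ?thesis using pJ by blast
  qed
  then show ?thesis unfolding mem comaximal_def by metis
qed

section \<open>Reduction of coefficients\<close>

text \<open>\<open>quot_map\<close> picks the only element of an image, so it has a meaning only
  when all representatives give the same coset; additivity of \<open>f\<close> and stability of
  \<open>I\<close> ensure this.\<close>

lemma (in ideal) quot_map_coset:
  assumes f: "\<And>x y. x \<in> carrier R \<Longrightarrow> y \<in> carrier R \<Longrightarrow> f (x \<oplus> y) = f x \<oplus> f y"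
    "\<And>x. x \<in> carrier R \<Longrightarrow> f x \<in> carrier R" "\<And>x. x \<in> I \<Longrightarrow> f x \<in> I"
    and u: "u \<in> carrier R"
  shows "quot_map R I f (I +> u) = I +> f u"
proof -
  have "I +> f v = I +> f u" if v: "v \<in> I +> u" for v
  proof -
    obtain j where j: "j \<in> I" "v = j \<oplus> u" using v by (auto simp: a_r_coset_def')
    then have "f v = f j \<oplus> f u" using f(1) u a_Hcarr by blast
    then have "f v \<in> I +> f u" using f(3)[OF j(1)] by (auto simp: a_r_coset_def')
    then show ?thesis using a_repr_independence'[OF _ f(2)[OF u]] by metis
  qed
  moreover have "u \<in> I +> u" using a_rcos_self u by blast
  ultimately have "(\<lambda>v. I +> f v) ` (I +> u) = {I +> f u}" by blast
  then show ?thesis by (simp add: quot_map_def)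
qed

lemma (in ideal) quot_map_twisted_ring:
  assumes "twisted_ring R f" and "\<And>x. x \<in> I \<Longrightarrow> f x \<in> I"
  shows "twisted_ring (R Quot I) (quot_map R I f)"
proof -
  interpret f: twisted_ring R f by fact
  interpret Q: ring "R Quot I" by (rule quotient_is_ring)
  have coset: "quot_map R I f (I +> u) = I +> f u" if "u \<in> carrier R" for u
    by (rule quot_map_coset) (use that assms(2) f.\<sigma>_add in auto)
  have carr: "carrier (R Quot I) = (\<lambda>x. I +> x) ` carrier R"
    by (auto simp: FactRing_def A_RCOSETS_def')
  note hom = rcos_ring_hom
  show ?thesis
  proof (intro twisted_ring.intro twisted_ring_axioms.intro Q.is_nonassoc_ring)
    fix X assume X: "X \<in> carrier (R Quot I)"
    then obtain x where x: "x \<in> carrier R" "X = I +> x" unfolding carr by blast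
    show "quot_map R I f X \<in> carrier (R Quot I)" using x by (simp add: coset carr)
    fix Y assume "Y \<in> carrier (R Quot I)"
    then obtain y where y: "y \<in> carrier R" "Y = I +> y" unfolding carr by blast
    show "quot_map R I f (X \<oplus>\<^bsub>R Quot I\<^esub> Y) = quot_map R I f X \<oplus>\<^bsub>R Quot I\<^esub> quot_map R I f Y"
      using x y by (simp add: coset f.\<sigma>_add flip: ring_hom_add[OF hom])
  next
    show "quot_map R I f \<one>\<^bsub>R Quot I\<^esub> = \<one>\<^bsub>R Quot I\<^esub>"
      by (simp add: coset flip: ring_hom_one[OF hom])
  qed
qed

text \<open>An automorphism of \<open>K\<close> fixes the integers, so it commutes with evaluating
  integer polynomials and sends a root of a monic one to a root of the same polynomial; hence it
  preserves O_K.\<close>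

lemma gal_twisted_ring:
  assumes K: "is_subfield_C K" and \<tau>: "\<tau> \<in> gal K F"
  shows "twisted_ring (OKr K) \<tau>"
proof -
  interpret cring "OKr K" by (rule ring_of_integers_cring[OF K])
  have \<tau>': "\<tau> ` K = K" "\<tau> 1 = 1" "\<And>x y. x \<in> K \<Longrightarrow> y \<in> K \<Longrightarrow> \<tau> (x + y) = \<tau> x + \<tau> y"
    "\<And>x y. x \<in> K \<Longrightarrow> y \<in> K \<Longrightarrow> \<tau> (x * y) = \<tau> x * \<tau> y"
    using \<tau> unfolding gal_def by blast+
  have sub: "ring_of_integers K \<subseteq> K" by (auto simp: ring_of_integers_def)
  interpret KR: cring "ring_of_set K" by (rule subfield_cring[OF K])
  note KR = KR.cring_axioms
  have \<tau>0: "\<tau> 0 = 0" using \<tau>'(3)[of 0 0] KR.zero_closed by simp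
  have \<tau>_minus: "\<tau> (- x) = - \<tau> x" if "x \<in> K" for x
  proof -
    have "\<tau> (- x) + \<tau> x = 0"
      using \<tau>'(3)[of "- x" x] that \<tau>0 KR.a_inv_closed[of x] ring_of_set_minus[OF KR that] by simp
    then show ?thesis by (simp add: eq_neg_iff_add_eq_0)
  qed
  have nat: "\<tau> (of_nat n) = of_nat n" for n
    by (induction n) (use \<tau>0 \<tau>' of_int_mem_ring[OF KR, of "int _"] of_int_mem_ring[OF KR, of 1] in auto)
  have int: "\<tau> (of_int k) = of_int k" for k
    by (cases k) (use nat \<tau>_minus of_int_mem_ring[OF KR, of "int _"] in \<open>auto simp del: of_nat_Suc\<close>)
  have poly: "\<tau> (poly (map_poly of_int p) x) = poly (map_poly of_int p) (\<tau> x)" if "x \<in> K" for p x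
  proof (induction p)
    case (pCons a p)
    have "poly (map_poly of_int p) x \<in> K" by (rule ipoly_mem_ring[OF KR that])
    then show ?case
      using pCons.IH that \<tau>' int of_int_mem_ring[OF KR] KR.m_closed
      by (simp add: of_int_hom.map_poly_pCons_hom)
  qed (simp add: \<tau>0)
  have "\<tau> x \<in> ring_of_integers K" if x: "x \<in> ring_of_integers K" for x
  proof -
    have xK: "x \<in> K" using x sub by blast
    obtain p where "poly (map_poly of_int p) x = 0" "lead_coeff p = (1 :: int)"
      using x unfolding ring_of_integers_def algebraic_int_altdef_ipoly by blast
    moreover from this(1) have "poly (map_poly of_int p) (\<tau> x) = 0" using poly[OF xK] \<tau>0 by metis
    ultimately have "algebraic_int (\<tau> x)" unfolding algebraic_int_altdef_ipoly by blast
    then show ?thesis using \<tau>'(1) xK by (auto simp: ring_of_integers_def)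
  qed
  then show ?thesis
    by (intro twisted_ring.intro twisted_ring_axioms.intro is_nonassoc_ring)
       (use subsetD[OF sub] \<tau>'(2,3) in auto)
qed

text \<open>An empty basis would make \<open>K\<close> zero. Positive degrees are what division by
  e^n - c and t^m - d relies on.\<close>

lemma cyclic_ext_degree_pos:
  assumes K: "is_subfield_C K" and "cyclic_ext K F n \<rho>"
  shows "n > 0"
proof (rule ccontr)
  assume "\<not> n > 0"
  then have "field_degree K F 0" using assms(2) by (simp add: cyclic_ext_def)
  then have "\<forall>x\<in>K. x = 0" unfolding field_degree_def by auto
  then show False using K unfolding is_subfield_C_def by (metis zero_neq_one)
qed

text \<open>A generator a x with \<open>a\<close> fixed is sent to a times the image of
  \<open>x\<close>, again of the required form. This makes the induced maps on residue rings well
  defined.\<close>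

lemma fixed_scalar_ext:
  assumes \<tau>: "twisted_ring (ring_of_set B) \<tau>" and B: "cring (ring_of_set B)" and S: "S \<subseteq> B"
    and mult: "\<And>x y. x \<in> B \<Longrightarrow> y \<in> B \<Longrightarrow> \<tau> (x * y) = \<tau> x * \<tau> y"
    and fixed: "\<And>a. a \<in> S \<Longrightarrow> \<tau> a = a"
    and y: "y \<in> scalar_ext (ring_of_set B) (\<lambda>a. a) S"
  shows "\<tau> y \<in> scalar_ext (ring_of_set B) (\<lambda>a. a) S"
proof -
  interpret \<tau>: twisted_ring "ring_of_set B" \<tau> by fact
  interpret B: cring "ring_of_set B" by fact
  from y show ?thesis
  proof induction
    case zero
    then show ?case using \<tau>.\<sigma>_zero scalar_ext.zero[of "ring_of_set B"] by simp
  next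
    case (step a x y)
    have "y \<in> B"
      using ideal_ring_of_setD(1)[OF B.scalar_ext_ideal[of S]] S step.hyps(3) by auto
    then have "\<tau> (a * x + y) = a * \<tau> x + \<tau> y"
      using \<tau>.\<sigma>_add[of "a * x" y] B.m_closed[of a x] step.hyps(1,2) S mult[of a x] fixed by auto
    then show ?case
      using scalar_ext.step[OF step.hyps(1) \<tau>.\<sigma>_closed[OF step.hyps(2)] step.IH] by simp
  qed
qed

text \<open>Serves to exclude zero primes from the factorization of a non-zero ideal; the exponent
  must be positive because the power with exponent 0 is the whole ring.\<close>

lemma (in ring) ideal_pow_zero:
  assumes "s > 0"
  shows "ideal_pow R {\<zero>} s = {\<zero>}"
  using assms
proof (cases s)
  case (Suc k)
  then show ?thesis
    using ideal_prod_zero[OF ideal_pow_ideal[OF ring_axioms zeroideal]] by simp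
qed simp

lemma (in ideal) rcos_minus_iff:
  assumes "x \<in> carrier R" "y \<in> carrier R"
  shows "I +> x = I +> y \<longleftrightarrow> x \<ominus> y \<in> I"
proof
  assume "I +> x = I +> y"
  then have "x \<in> I +> y" using a_rcos_self[OF assms(1)] by simp
  then obtain i where i: "i \<in> I" "x = i \<oplus> y" by (auto simp: a_r_coset_def')
  then have "x \<ominus> y = i" using assms a_Hcarr by (simp add: minus_eq a_assoc r_neg)
  then show "x \<ominus> y \<in> I" using i by simp
next
  assume h: "x \<ominus> y \<in> I"
  have "x = (x \<ominus> y) \<oplus> y" using assms by (simp add: minus_eq a_assoc l_neg)
  then have "x \<in> I +> y" using h by (auto simp: a_r_coset_def')
  then show "I +> x = I +> y" using a_repr_independence'[OF _ assms(2)] a_subgroup by metis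
qed

lemma petit_petit_carrier:
  assumes "petit_tm_data R \<rho> n c" "petit_tm_data (petit_tm R \<rho> n c) \<sigma> m d"
  shows "p \<in> carrier (petit_tm (petit_tm R \<rho> n c) \<sigma> m d) \<longleftrightarrow>
    (\<forall>i k. p i k \<in> carrier R) \<and> (\<forall>i k. i \<ge> m \<or> k \<ge> n \<longrightarrow> p i k = \<zero>\<^bsub>R\<^esub>)"
proof -
  interpret R: petit_tm_data R \<rho> n c by fact
  interpret D: petit_tm_data R.P \<sigma> m d by fact
  show ?thesis unfolding D.carrier_P_iff R.carrier_P_iff R.P_simps(4) fun_eq_iff by blast
qed

text \<open>Two applications of \<open>petit_map_hom\<close>: the residue map induces a homomorphism
  on the inner algebras, and that one induces a homomorphism on the outer algebras.\<close>

lemma (in cring) petit_petit_reduction: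
  assumes J: "ideal J R" and \<rho>: "twisted_ring R \<rho>" "\<And>x. x \<in> J \<Longrightarrow> \<rho> x \<in> J"
    and \<sigma>: "twisted_ring R \<sigma>" "\<And>x. x \<in> J \<Longrightarrow> \<sigma> x \<in> J"
    and mn: "m > 0" "n > 0" and cd: "c \<in> carrier R" "d \<in> carrier R"
  defines "D \<equiv> petit_tm R \<rho> n c"
    and "D' \<equiv> petit_tm (R Quot J) (quot_map R J \<rho>) n (J +> c)"
  shows "petit_tm_data R \<rho> n c" "petit_tm_data D (coeffwise \<sigma>) m (cst R d)"
    and "petit_tm_data (R Quot J) (quot_map R J \<rho>) n (J +> c)"
    and "petit_tm_data D' (coeffwise (quot_map R J \<sigma>)) m (cst (R Quot J) (J +> d))"
    and "(\<lambda>p i k. J +> p i k) \<in> ring_hom (petit_tm D (coeffwise \<sigma>) m (cst R d))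
           (petit_tm D' (coeffwise (quot_map R J \<sigma>)) m (cst (R Quot J) (J +> d)))"
proof -
  interpret J: ideal J R by fact
  interpret \<rho>: twisted_ring R \<rho> by fact
  interpret \<sigma>: twisted_ring R \<sigma> by fact
  note hom = J.rcos_ring_hom
  note Q\<rho> = J.quot_map_twisted_ring[OF \<rho>] and Q\<sigma> = J.quot_map_twisted_ring[OF \<sigma>]
  interpret Q: nonassoc_ring "R Quot J" by (rule twisted_ring.axioms(1)[OF Q\<rho>])
  show R: "petit_tm_data R \<rho> n c"
    by (intro petit_tm_data.intro petit_tm_data_axioms.intro \<rho> mn cd)
  show Q: "petit_tm_data (R Quot J) (quot_map R J \<rho>) n (J +> c)"
    by (intro petit_tm_data.intro petit_tm_data_axioms.intro Q\<rho> mn ring_hom_closed[OF hom] cd)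
  interpret R: petit_tm_data R \<rho> n c by (rule R)
  interpret Q: petit_tm_data "R Quot J" "quot_map R J \<rho>" n "J +> c" by (rule Q)
  have "cst R d \<in> carrier D"
    unfolding D_def R.carrier_P_iff using mn cd by (simp add: cst_def)
  then show D: "petit_tm_data D (coeffwise \<sigma>) m (cst R d)"
    unfolding D_def by (intro petit_tm_data.intro petit_tm_data_axioms.intro R.petit_twisted_ring \<sigma> mn)
  have "cst (R Quot J) (J +> d) \<in> carrier D'"
    unfolding D'_def Q.carrier_P_iff using mn ring_hom_closed[OF hom cd(2)] by (simp add: cst_def)
  then show D': "petit_tm_data D' (coeffwise (quot_map R J \<sigma>)) m (cst (R Quot J) (J +> d))"
    unfolding D'_def by (intro petit_tm_data.intro petit_tm_data_axioms.intro Q.petit_twisted_ring Q\<sigma> mn)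
  have coset_\<rho>: "J +> \<rho> u = quot_map R J \<rho> (J +> u)" if "u \<in> carrier R" for u
    by (rule J.quot_map_coset[symmetric]) (use that \<rho>(2) \<rho>.\<sigma>_add in auto)
  have coset_\<sigma>: "J +> \<sigma> u = quot_map R J \<sigma> (J +> u)" if "u \<in> carrier R" for u
    by (rule J.quot_map_coset[symmetric]) (use that \<sigma>(2) \<sigma>.\<sigma>_add in auto)
  have zero: "J +> \<zero> = \<zero>\<^bsub>R Quot J\<^esub>"
    by (rule ring_hom_zero'[OF is_nonassoc_ring Q.nonassoc_ring_axioms hom])
  have hom_D: "(\<lambda>p k. J +> p k) \<in> ring_hom D D'"
    unfolding D_def D'_def by (rule petit_map_hom[OF R Q hom coset_\<rho> refl])
  show "(\<lambda>p i k. J +> p i k) \<in> ring_hom (petit_tm D (coeffwise \<sigma>) m (cst R d))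
      (petit_tm D' (coeffwise (quot_map R J \<sigma>)) m (cst (R Quot J) (J +> d)))"
  proof (rule petit_map_hom[OF D D' hom_D])
    fix x assume "x \<in> carrier D"
    then show "(\<lambda>k. J +> coeffwise \<sigma> x k) = coeffwise (quot_map R J \<sigma>) (\<lambda>k. J +> x k)"
      unfolding D_def R.carrier_P_iff by (simp add: coeffwise_def coset_\<sigma>)
  next
    show "(\<lambda>k. J +> cst R d k) = cst (R Quot J) (J +> d)"
      by (rule ext) (auto simp: cst_def zero split: if_split)
  qed
qed

section \<open>The isomorphism for \<Lambda>\<close>

theorem theorem3:
  fixes F L K :: "complex set" and n m :: nat and \<rho> \<sigma> :: "complex \<Rightarrow> complex"
    and c d :: complex and I :: "complex set" and l :: nat
    and q :: "nat \<Rightarrow> complex set" and s :: "nat \<Rightarrow> nat"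
  assumes "is_number_field F" and "is_number_field L" and "is_number_field K"
    and "cyclic_ext K F n \<rho>" and "cyclic_ext K L m \<sigma>" and "\<rho> \<circ> \<sigma> = \<sigma> \<circ> \<rho>"
    and "c \<in> units_of_set (ring_of_integers (F \<inter> L))"
    and "is_division_ring (petit_tm (ring_of_set K) \<rho> n c)"
    and "d \<in> units_of_set (ring_of_integers L)"
    and "irreducible_in (skew_poly_ring (petit_tm (ring_of_set K) \<rho> n c) (coeffwise \<sigma>))
           (tm_minus (petit_tm (ring_of_set K) \<rho> n c) m (cst (ring_of_set K) d))"
    and "ideal I (OKr (F \<inter> L))" and "I \<noteq> {0}"
    and "\<forall>j\<in>{1..l}. primeideal (q j) (OKr (F \<inter> L)) \<and> s j > 0"
    and "inj_on q {1..l}"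
    and "I = ideal_prod_list (OKr (F \<inter> L))
               (map (\<lambda>j. ideal_pow (OKr (F \<inter> L)) (q j) (s j)) [1..<Suc l])"
    and "ring_isom (nat_order K \<rho> n c Quot scalar_ext (nat_order K \<rho> n c) (cst (OKr K)) I)
           (prod_ring l (\<lambda>j. res_cyclic K (Idl\<^bsub>OKr K\<^esub> (ideal_pow (OKr (F \<inter> L)) (q j) (s j))) \<rho> n c))"
  shows "ring_isom (Lambda_ord K \<rho> n c \<sigma> m d Quot
             scalar_ext (Lambda_ord K \<rho> n c \<sigma> m d) (\<lambda>a. cst (nat_order K \<rho> n c) (cst (OKr K) a)) I)
           (prod_ring l (\<lambda>j. res_petit K (Idl\<^bsub>OKr K\<^esub> (ideal_pow (OKr (F \<inter> L)) (q j) (s j))) \<rho> n c \<sigma> m d))"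
proof -
  define A where "A = ring_of_integers (F \<inter> L)"
  define B where "B = ring_of_integers K"
  define P where "P = (\<lambda>j. ideal_pow (OKr (F \<inter> L)) (q j) (s j))"
  define ext where "ext = scalar_ext (ring_of_set B) (\<lambda>a. a)"
  have sub: "F \<subseteq> K" "L \<subseteq> K" and gal: "\<rho> \<in> gal K F" "\<sigma> \<in> gal K L"
    using assms(4,5) by (auto simp: cyclic_ext_def)
  have K: "is_subfield_C K" using assms(3) by (simp add: is_number_field_def)
  have Acr: "cring (ring_of_set A)"
    unfolding A_def using assms(1,2)
    by (intro ring_of_integers_cring) (auto simp: is_number_field_def is_subfield_C_def)
  have Bcr: "cring (ring_of_set B)" unfolding B_def by (rule ring_of_integers_cring[OF K])
  interpret A: cring "ring_of_set A" by (rule Acr)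
  interpret B: cring "ring_of_set B" by (rule Bcr)
  have AB: "A \<subseteq> B" using sub by (auto simp: A_def B_def ring_of_integers_def)
  have cd: "c \<in> B" "d \<in> B"
    using assms(7,9) sub by (auto simp: units_of_set_def B_def ring_of_integers_def)
  have mn: "m > 0" "n > 0" using cyclic_ext_degree_pos[OF K] assms(4,5) by blast+
  interpret \<rho>: twisted_ring "ring_of_set B" \<rho> unfolding B_def by (rule gal_twisted_ring[OF K gal(1)])
  interpret \<sigma>: twisted_ring "ring_of_set B" \<sigma> unfolding B_def by (rule gal_twisted_ring[OF K gal(2)])

  have q: "primeideal (q j) (ring_of_set A)" "s j > 0" if "j \<in> {1..l}" for j
    using assms(13) that by (auto simp: A_def)
  then have qI: "ideal (q j) (ring_of_set A)" if "j \<in> {1..l}" for j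
    using that by (auto dest: primeideal.axioms(1))
  have PI: "ideal (P j) (ring_of_set A)" if "j \<in> {1..l}" for j
    using ideal_pow_ideal[OF A.ring_axioms qI[OF that]] by (simp add: P_def A_def)
  have js: "set [1..<Suc l] = {1..l}" by auto
  have I_eq: "I = ideal_prod_list (ring_of_set A) (map P [1..<Suc l])"
    using assms(15) by (simp only: P_def A_def)
  have I_le: "I \<subseteq> P j" if "j \<in> {1..l}" for j
    unfolding I_eq
  proof (rule A.ideal_prod_list_subset)
    show "\<forall>J\<in>set (map P [1..<Suc l]). ideal J (ring_of_set A)" unfolding set_map js using PI by blast
    show "P j \<in> set (map P [1..<Suc l])" unfolding set_map js using that by blast
  qed
  \<comment> \<open>\<open>I\<close> is contained in every \<open>P j\<close>, so a zero prime with
    its positive exponent would force \<open>I\<close> to be zero.\<close>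
  have q_nonzero: "q j \<noteq> {0}" if j: "j \<in> {1..l}" for j
  proof
    assume "q j = {0}"
    then have "P j = {0}" using A.ideal_pow_zero[OF q(2)[OF j]] by (simp add: P_def A_def)
    then show False using I_le[OF j] assms(11,12) ideal_ring_of_setD(2) by blast
  qed
  have P_comax: "comaximal (P i) (P j)" if ij: "i \<in> {1..l}" "j \<in> {1..l}" "i \<noteq> j" for i j
  proof -
    have "q i \<noteq> q j" using inj_onD[OF assms(14)] ij by blast
    moreover have "algebraic_int x" if "x \<in> A" for x using that by (simp add: A_def ring_of_integers_def)
    ultimately have "comaximal (q i) (q j)"
      using distinct_primes_comaximal[OF Acr _ q(1)[OF ij(1)] q_nonzero[OF ij(1)] q(1)[OF ij(2)] q_nonzero[OF ij(2)]]
      by blast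
    \<comment> \<open>Exponents are introduced on one side at a time: first on \<open>q j\<close>
      against \<open>q i\<close>, then, with the sides exchanged, on \<open>q i\<close> against
      \<open>P j\<close>.\<close>
    from comaximal_ideal_pow[OF Acr qI[OF ij(1)] qI[OF ij(2)] this, of "s j"]
    have "comaximal (P j) (q i)" by (simp add: P_def A_def comaximal_sym)
    from comaximal_ideal_pow[OF Acr PI[OF ij(2)] qI[OF ij(1)] this, of "s i"]
    show ?thesis by (simp add: P_def A_def comaximal_sym)
  qed
  have crt_ex: "\<exists>z\<in>B. \<forall>j\<in>{1..l}. z - x j \<in> ext (P j)" if "\<forall>j\<in>{1..l}. x j \<in> B" for x
    using chinese_remainder_extension(1)[OF Acr Bcr AB distinct_upt, of 1 "Suc l" P x] PI P_comax that
    unfolding js ext_def by blast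
  have crt_ker: "{y \<in> B. \<forall>j\<in>{1..l}. y \<in> ext (P j)} = ext I"
    using chinese_remainder_extension(2)[OF Acr Bcr AB distinct_upt, of 1 "Suc l" P] PI P_comax
    unfolding js ext_def I_eq by blast

  define Q where "Q = (\<lambda>j. Idl\<^bsub>OKr K\<^esub> (P j))"
  have Q_eq: "Q j = ext (P j)" and QI: "ideal (Q j) (ring_of_set B)" if j: "j \<in> {1..l}" for j
  proof -
    have PB: "P j \<subseteq> carrier (ring_of_set B)"
      using ideal_ring_of_setD(1)[OF PI[OF j]] AB by simp
    then show "Q j = ext (P j)" unfolding Q_def ext_def B_def[symmetric] by (rule B.genideal_eq_scalar_ext)
    show "ideal (Q j) (ring_of_set B)" unfolding Q_def B_def[symmetric] by (rule B.genideal_ideal[OF PB])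
  qed
  \<comment> \<open>\<open>P j\<close> lies in both F and L, so either Galois group fixes it
    elementwise; \<open>E\<close> lets one argument serve \<rho> and \<sigma>.\<close>
  have fixed: "\<tau> y \<in> Q j"
    if \<tau>: "\<tau> \<in> gal K E" "E \<in> {F, L}" and j: "j \<in> {1..l}" and y: "y \<in> Q j" for \<tau> E j y
  proof -
    have BK: "B \<subseteq> K" by (auto simp: B_def ring_of_integers_def)
    have mult: "\<tau> (x * y) = \<tau> x * \<tau> y" if "x \<in> B" "y \<in> B" for x y
      using \<tau>(1) subsetD[OF BK that(1)] subsetD[OF BK that(2)] unfolding gal_def by blast
    have PA: "P j \<subseteq> A" by (rule ideal_ring_of_setD(1)[OF PI[OF j]])
    then have "a \<in> E" if "a \<in> P j" for a
      using that \<tau>(2) by (auto simp: A_def ring_of_integers_def)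
    then have fix_P: "\<tau> a = a" if "a \<in> P j" for a
      using that \<tau>(1) unfolding gal_def by blast
    have "\<tau> y \<in> ext (P j)"
      using gal_twisted_ring[OF K \<tau>(1)] Bcr subset_trans[OF PA AB] mult fix_P y[unfolded Q_eq[OF j] ext_def]
      unfolding B_def[symmetric] ext_def by (rule fixed_scalar_ext)
    then show ?thesis by (simp only: Q_eq[OF j])
  qed
  define D where "D = petit_tm (ring_of_set B) \<rho> n c"
  define \<Lambda> where "\<Lambda> = petit_tm D (coeffwise \<sigma>) m (cst (ring_of_set B) d)"
  define \<Lambda>' where "\<Lambda>' = (\<lambda>j. res_petit K (Q j) \<rho> n c \<sigma> m d)"
  define \<phi> where "\<phi> = (\<lambda>j x. Q j +>\<^bsub>ring_of_set B\<^esub> x)"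
  have D_eq: "nat_order K \<rho> n c = D" by (simp add: nat_order_def D_def B_def)
  have \<Lambda>_eq: "Lambda_ord K \<rho> n c \<sigma> m d = \<Lambda>" by (simp add: Lambda_ord_def D_eq \<Lambda>_def B_def)
  have RD: "petit_tm_data (ring_of_set B) \<rho> n c"
    by (intro petit_tm_data.intro petit_tm_data_axioms.intro \<rho>.twisted_ring_axioms mn) (simp add: cd)
  interpret RD: petit_tm_data "ring_of_set B" \<rho> n c by (rule RD)
  have DD: "petit_tm_data D (coeffwise \<sigma>) m (cst (ring_of_set B) d)"
    unfolding D_def
    by (intro petit_tm_data.intro petit_tm_data_axioms.intro RD.petit_twisted_ring \<sigma>.twisted_ring_axioms mn)
       (use mn cd B.zero_closed in \<open>simp add: RD.carrier_P_iff cst_def\<close>)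
  interpret DD: petit_tm_data D "coeffwise \<sigma>" m "cst (ring_of_set B) d" by (rule DD)
  have \<Lambda>_ring: "nonassoc_ring \<Lambda>" using DD.petit_nonassoc_ring by (simp add: \<Lambda>_def)
  have carr_\<Lambda>: "p \<in> carrier \<Lambda> \<longleftrightarrow> (\<forall>i k. p i k \<in> B) \<and> (\<forall>i k. i \<ge> m \<or> k \<ge> n \<longrightarrow> p i k = 0)" for p
    using petit_petit_carrier[OF RD DD[unfolded D_def]] by (simp add: \<Lambda>_def D_def)
  \<comment> \<open>The carrier is described through representatives in O_K, with
    \<open>\<phi> j 0\<close> as the zero coset; lifting an element then becomes a question about
    single coefficients.\<close>
  have hom: "(\<lambda>p i k. \<phi> j (p i k)) \<in> ring_hom \<Lambda> (\<Lambda>' j)"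
    and carr': "y \<in> carrier (\<Lambda>' j) \<longleftrightarrow> (\<forall>i k. \<exists>x\<in>B. y i k = \<phi> j x) \<and> (\<forall>i k. i \<ge> m \<or> k \<ge> n \<longrightarrow> y i k = \<phi> j 0)"
    if j: "j \<in> {1..l}" for j y
  proof -
    interpret QI: ideal "Q j" "ring_of_set B" by (rule QI[OF j])
    interpret Quot: ring "ring_of_set B Quot Q j" by (rule QI.quotient_is_ring)
    have c': "c \<in> carrier (ring_of_set B)" "d \<in> carrier (ring_of_set B)" using cd by simp_all
    note R = B.petit_petit_reduction[OF QI[OF j] \<rho>.twisted_ring_axioms fixed[OF gal(1) insertI1 j]
        \<sigma>.twisted_ring_axioms fixed[OF gal(2) insertI2[OF insertI1] j] mn c']
    have \<Lambda>'_eq: "\<Lambda>' j = petit_tm (petit_tm (ring_of_set B Quot Q j) (quot_map (ring_of_set B) (Q j) \<rho>) n (\<phi> j c))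
        (coeffwise (quot_map (ring_of_set B) (Q j) \<sigma>)) m (cst (ring_of_set B Quot Q j) (\<phi> j d))"
      by (simp add: \<Lambda>'_def res_petit_def res_cyclic_def B_def \<phi>_def)
    show "(\<lambda>p i k. \<phi> j (p i k)) \<in> ring_hom \<Lambda> (\<Lambda>' j)"
      using R(5) by (simp only: \<Lambda>'_eq \<Lambda>_def D_def \<phi>_def)
    have "X \<in> carrier (ring_of_set B Quot Q j) \<longleftrightarrow> (\<exists>x\<in>B. X = \<phi> j x)" for X
      by (auto simp: FactRing_def A_RCOSETS_def' \<phi>_def)
    moreover have "\<zero>\<^bsub>ring_of_set B Quot Q j\<^esub> = \<phi> j 0"
      using ring_hom_zero'[OF B.is_nonassoc_ring Quot.is_nonassoc_ring QI.rcos_ring_hom] by (simp add: \<phi>_def)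
    ultimately show "y \<in> carrier (\<Lambda>' j) \<longleftrightarrow>
        (\<forall>i k. \<exists>x\<in>B. y i k = \<phi> j x) \<and> (\<forall>i k. i \<ge> m \<or> k \<ge> n \<longrightarrow> y i k = \<phi> j 0)"
      using petit_petit_carrier[OF R(3) R(4), of y] by (simp only: \<Lambda>'_eq \<phi>_def)
  qed
  have \<phi>_eq: "\<phi> j x = \<phi> j y \<longleftrightarrow> x - y \<in> Q j" if "j \<in> {1..l}" "x \<in> B" "y \<in> B" for j x y
    using ideal.rcos_minus_iff[OF QI[OF that(1)], of x y] that(2,3)
    by (simp add: \<phi>_def a_minus_def ring_of_set_minus[OF Bcr])
  define J where "J = scalar_ext \<Lambda> (\<lambda>a. cst D (cst (ring_of_set B) a)) I"
  have I_B: "I \<subseteq> B" using ideal_ring_of_setD(1)[OF assms(11)] AB by (simp add: A_def)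
  have cst_D: "cst (ring_of_set B) a \<in> carrier D" if "a \<in> I" for a
    unfolding D_def using mn subsetD[OF I_B that] B.zero_closed by (simp add: RD.carrier_P_iff cst_def)
  \<comment> \<open>\<open>scalar_ext_petit\<close> is applied at both levels, which brings
    I\<Lambda> down to a condition on the coefficients p i k in O_K.\<close>
  have J_eq: "J = {p \<in> carrier \<Lambda>. \<forall>i k. p i k \<in> ext I}"
  proof -
    have "J = {p \<in> carrier \<Lambda>. \<forall>i. p i \<in> scalar_ext D (cst (ring_of_set B)) I}"
      unfolding J_def \<Lambda>_def by (rule DD.scalar_ext_petit) (rule cst_D)
    also have "scalar_ext D (cst (ring_of_set B)) I = {p \<in> carrier D. \<forall>k. p k \<in> ext I}"
      unfolding D_def ext_def by (rule RD.scalar_ext_petit) (use I_B in auto)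
    finally show ?thesis unfolding \<Lambda>_def DD.carrier_P_iff by blast
  qed
  define H where "H = (\<lambda>p. \<lambda>j\<in>{1..l}. \<lambda>(i :: nat) (k :: nat). \<phi> j (p i k))"
  have H_hom: "H \<in> ring_hom \<Lambda> (prod_ring l \<Lambda>')"
  proof (rule ring_hom_memI)
    fix x assume x: "x \<in> carrier \<Lambda>"
    show "H x \<in> carrier (prod_ring l \<Lambda>')"
      using ring_hom_closed[OF hom x] by (simp add: prod_ring_def H_def)
    fix y assume y: "y \<in> carrier \<Lambda>"
    show "H (x \<otimes>\<^bsub>\<Lambda>\<^esub> y) = H x \<otimes>\<^bsub>prod_ring l \<Lambda>'\<^esub> H y"
      using ring_hom_mult[OF hom x y] by (auto simp: prod_ring_def H_def)
    show "H (x \<oplus>\<^bsub>\<Lambda>\<^esub> y) = H x \<oplus>\<^bsub>prod_ring l \<Lambda>'\<^esub> H y"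
      using ring_hom_add[OF hom x y] by (auto simp: prod_ring_def H_def)
  next
    show "H \<one>\<^bsub>\<Lambda>\<^esub> = \<one>\<^bsub>prod_ring l \<Lambda>'\<^esub>"
      using ring_hom_one[OF hom] by (auto simp: prod_ring_def H_def)
  qed
  have "y \<in> H ` carrier \<Lambda>" if y: "y \<in> carrier (prod_ring l \<Lambda>')" for y
  proof -
    have yj: "y j \<in> carrier (\<Lambda>' j)" if "j \<in> {1..l}" for j using y that by (auto simp: prod_ring_def)
    \<comment> \<open>For fixed i and k the components of \<open>y\<close> are residues modulo the
      different \<open>Q j\<close>; the Chinese remainder theorem supplies one representative for
      all of them.\<close>
    have "\<exists>z\<in>B. \<forall>j\<in>{1..l}. y j i k = \<phi> j z" for i k
    proof -
      have "\<forall>j\<in>{1..l}. \<exists>x\<in>B. y j i k = \<phi> j x" using yj carr' by blast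
      then obtain x where x: "\<forall>j\<in>{1..l}. x j \<in> B" "\<forall>j\<in>{1..l}. y j i k = \<phi> j (x j)" by metis
      obtain z where z: "z \<in> B" "\<forall>j\<in>{1..l}. z - x j \<in> ext (P j)" using crt_ex[OF x(1)] by blast
      have "y j i k = \<phi> j z" if "j \<in> {1..l}" for j
        using \<phi>_eq[OF that z(1), of "x j"] x z(2) Q_eq that by simp
      then show ?thesis using z(1) by blast
    qed
    then obtain z where z: "\<And>i k. z i k \<in> B" "\<And>i k j. j \<in> {1..l} \<Longrightarrow> y j i k = \<phi> j (z i k)" by metis
    \<comment> \<open>Outside the degree bounds the chosen lift is only known to reduce to zero.
      Replacing it by 0 there yields an element of \<Lambda> without changing any residue.\<close>
    let ?z = "\<lambda>i k. if i \<ge> m \<or> k \<ge> n then 0 else z i k"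
    have "?z \<in> carrier \<Lambda>" using z(1) B.zero_closed by (simp add: carr_\<Lambda>)
    moreover have "\<phi> j (?z i k) = y j i k" if "j \<in> {1..l}" for i j k
      using z(2)[OF that] yj[OF that] carr'[OF that] by simp
    then have "H ?z = y" using y by (auto simp: H_def prod_ring_def PiE_def extensional_def fun_eq_iff)
    ultimately show ?thesis by blast
  qed
  then have surj: "H ` carrier \<Lambda> = carrier (prod_ring l \<Lambda>')"
    using ring_hom_closed[OF H_hom] by blast
  have ker: "H x = H y \<longleftrightarrow> x \<ominus>\<^bsub>\<Lambda>\<^esub> y \<in> J" if x: "x \<in> carrier \<Lambda>" and y: "y \<in> carrier \<Lambda>" for x y
  proof -
    interpret \<Lambda>: nonassoc_ring \<Lambda> by (rule \<Lambda>_ring)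
    have B: "x i k \<in> B" "y i k \<in> B" for i k using x y carr_\<Lambda> by blast+
    have yD: "y i \<in> carrier D" for i using y by (simp add: \<Lambda>_def DD.carrier_P_iff)
    have "(x \<ominus>\<^bsub>\<Lambda>\<^esub> y) i k = x i k - y i k" for i k
      using y yD[of i] B
      by (simp add: a_minus_def \<Lambda>_def DD.petit_minus DD.P_simps(5) skew_add_def)
         (simp add: D_def RD.petit_minus RD.P_simps(5) skew_add_def ring_of_set_minus[OF Bcr])
    moreover have "x i k - y i k \<in> B" for i k
      using B.minus_closed[of "x i k" "y i k"] B by (simp add: a_minus_def ring_of_set_minus[OF Bcr])
    \<comment> \<open>By \<open>crt_ker\<close>, membership of a coefficient in the extension of
      \<open>I\<close> means membership in the extension of every \<open>P j\<close>, that is,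
      equality of the residues in every factor.\<close>
    ultimately have "x \<ominus>\<^bsub>\<Lambda>\<^esub> y \<in> J \<longleftrightarrow> (\<forall>i k. \<forall>j\<in>{1..l}. x i k - y i k \<in> ext (P j))"
      using x y unfolding J_eq crt_ker[symmetric] by simp
    also have "\<dots> \<longleftrightarrow> (\<forall>j\<in>{1..l}. \<forall>i k. \<phi> j (x i k) = \<phi> j (y i k))"
      using \<phi>_eq B Q_eq by auto
    also have "\<dots> \<longleftrightarrow> H x = H y" by (auto simp: H_def fun_eq_iff restrict_def)
    finally show ?thesis by simp
  qed
  have "ring_isom (\<Lambda> Quot J) (prod_ring l \<Lambda>')"
    by (rule quot_isomI[OF \<Lambda>_ring _ H_hom surj ker]) (auto simp: J_eq)
  then show ?thesis
    unfolding \<Lambda>_eq D_eq J_def \<Lambda>'_def Q_def P_def B_def .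
qed

end
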